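(* Let $0<|q|<1$ and let $n=1,2,3,\dots$. Then $$\vartheta_3(0,-q)^{4n^2}=\left\{(-1)^n2^{2n^2+n}\prod_{r=1}^{2n-1}(r!)^{-1}\right\}\cdot\det\left(g_{r+s-1}\right)_{1\le r,s\le n},$$ where $g_i:=U_{2i-1}-c_i$, and for $i=1,2,3,\dots$ $$U_{2i-1}\equiv U_{2i-1}(q):=\sum_{r=1}^{\infty}(-1)^{r-1}\frac{r^{2i-1}q^r}{1+q^r},\qquad c_i:=(-1)^{i-1}\frac{2^{2i}-1}{4i}\,|B_{2i}|.$$
   Context: $\vartheta_3(0,q):=\sum_{j=-\infty}^{\infty}q^{j^2}$, so $\vartheta_3(0,-q)=\sum_{j=-\infty}^{\infty}(-1)^{j}q^{j^2}$. The Bernoulli numbers $B_n$ are defined by $\frac{t}{e^t-1}=\sum_{n=0}^{\infty}B_n\frac{t^n}{n!}$, $|t|<2\pi$. *)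

theory Defs
  imports
    "HOL-Complex_Analysis.Complex_Analysis"
    "Jordan_Normal_Form.Determinant"
begin

(* For |q| < 1 the series theta3_0 and U_series below converge absolutely, so the
   unordered sums are the usual ones. *)
definition theta3_0 :: "complex \<Rightarrow> complex" where
  "theta3_0 q = (\<Sum>\<^sub>\<infinity>j::int. q powi (j\<^sup>2))"

(* The generating function is taken as a quotient of formal power series;
   bernoulli_sums recovers the analytic identity on |t| < 2 pi. *)
definition bernoulli :: "nat \<Rightarrow> real" where
  "bernoulli n = fact n * fps_nth (fps_X / (fps_exp 1 - 1)) n"

lemma bernoulli_fps_mult:
  "Abs_fps (\<lambda>n. of_real (bernoulli n) / fact n) * (fps_exp 1 - 1) = (fps_X :: complex fps)"
proof -
  define F :: "real fps" where "F = fps_X / (fps_exp 1 - 1)"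
  have sd: "subdegree (fps_exp 1 - 1 :: real fps) = 1"
    by (rule subdegreeI) auto
  have "fps_exp 1 - 1 dvd (fps_X :: real fps)"
    using sd by (subst fps_dvd_iff) auto
  hence eq: "F * (fps_exp 1 - 1) = fps_X"
    by (simp add: F_def)
  have b: "of_real (bernoulli n) / fact n = (of_real (fps_nth F n) :: complex)" for n
    by (simp add: bernoulli_def F_def)
  show ?thesis
  proof (rule fps_ext)
    fix n
    have "fps_nth (Abs_fps (\<lambda>n. of_real (bernoulli n) / fact n) * (fps_exp 1 - 1)) n
        = (of_real (fps_nth (F * (fps_exp 1 - 1)) n) :: complex)"
      unfolding b fps_mult_nth of_real_sum
      by (intro sum.cong refl) simp
    also have "\<dots> = fps_nth fps_X n"
      by (simp add: eq)
    finally show "fps_nth (Abs_fps (\<lambda>n. of_real (bernoulli n) / fact n) * (fps_exp 1 - 1)) n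
        = (fps_nth fps_X n :: complex)" .
  qed
qed

lemma bernoulli_sums:
  fixes t :: complex
  assumes "norm t < 2 * pi" "t \<noteq> 0"
  shows "(\<lambda>n. of_real (bernoulli n) * t ^ n / fact n) sums (t / (exp t - 1))"
proof -
  define B :: "complex fps" where "B = Abs_fps (\<lambda>n. of_real (bernoulli n) / fact n)"
  define G :: "complex fps" where "G = fps_exp 1 - 1"
  define f :: "complex \<Rightarrow> complex" where "f = (\<lambda>z. if z = 0 then 1 else z / (exp z - 1))"
  have sd: "subdegree G = 1"
    unfolding G_def by (rule subdegreeI) auto
  have G0: "G \<noteq> 0"
    using sd by auto
  have B: "fps_X / G = B"
    using bernoulli_fps_mult G0 unfolding B_def G_def
    by (metis nonzero_mult_div_cancel_right)
  have "(\<lambda>z. exp z - 1 :: complex) has_fps_expansion G"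
    unfolding G_def by (intro fps_expansion_intros)
  hence "(\<lambda>z. if z = 0 then 1 else z / (exp z - 1)) has_fps_expansion (fps_X / G)"
    using sd G0 by (intro has_fps_expansion_divide fps_expansion_intros) (auto simp: G_def)
  hence exp_f: "f has_fps_expansion B"
    by (simp add: f_def B)
  have nz: "exp z \<noteq> 1" if "norm z < 2 * pi" "z \<noteq> 0" for z :: complex
  proof
    assume "exp z = 1"
    then obtain k :: int where k: "Re z = 0" "Im z = of_int (2 * k) * pi"
      by (auto simp: exp_eq_1)
    have "k \<noteq> 0"
      using k that(2) by (auto simp: complex_eq_iff)
    hence "1 \<le> \<bar>real_of_int k\<bar>"
      by linarith
    hence "2 * pi \<le> \<bar>Im z\<bar>"
      by (simp add: k abs_mult)
    with abs_Im_le_cmod[of z] that(1) show False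
      by linarith
  qed
  have "f holomorphic_on ball 0 (2 * pi)"
  proof (rule no_isolated_singularity')
    show "f holomorphic_on ball 0 (2 * pi) - {0}"
    proof (rule holomorphic_transform)
      show "(\<lambda>z. z / (exp z - 1)) holomorphic_on ball 0 (2 * pi) - {0}"
        using nz by (intro holomorphic_intros) auto
    qed (auto simp: f_def)
    show "(f \<longlongrightarrow> f z) (at z within ball 0 (2 * pi))" if "z \<in> {0}" for z
      using has_fps_expansion_imp_continuous[OF exp_f, of "ball 0 (2 * pi)"] that
      by (auto simp: continuous_within)
  qed auto
  hence "f holomorphic_on eball 0 (ereal (2 * pi))"
    by simp
  hence "(\<lambda>n. fps_nth B n * t ^ n) sums f t"
    using assms exp_f by (intro has_fps_expansion_imp_sums_complex[where r = "ereal (2 * pi)"]) auto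
  thus ?thesis
    using assms by (simp add: B_def f_def)
qed

definition U_series :: "nat \<Rightarrow> complex \<Rightarrow> complex" where
  "U_series m q = (\<Sum>\<^sub>\<infinity>r\<in>{1::nat..}. (-1) ^ (r - 1) * (of_nat r ^ m * q ^ r / (1 + q ^ r)))"

definition c_coeff :: "nat \<Rightarrow> real" where
  "c_coeff i = (-1) ^ (i - 1) * ((2 ^ (2 * i) - 1) / (4 * real i)) * \<bar>bernoulli (2 * i)\<bar>"

definition g_coeff :: "complex \<Rightarrow> nat \<Rightarrow> complex" where
  "g_coeff q i = U_series (2 * i - 1) q - of_real (c_coeff i)"

(* Matrix entries are indexed from 0: the entry in position (r, s), 1 <= r, s <= n,
   is found at index (r - 1, s - 1), whence r + s - 1 = (r - 1) + (s - 1) + 1. *)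
definition g_mat :: "complex \<Rightarrow> nat \<Rightarrow> complex mat" where
  "g_mat q n = mat n n (\<lambda>(i, j). g_coeff q (i + j + 1))"

end

theory Submission
  imports Defs
begin

text \<open>
  Put \<open>z = e\<^sup>t\<close> and let \<open>k(t) = 2 (g\<^sub>1 t + g\<^sub>2 t\<^sup>3/3! + g\<^sub>3 t\<^sup>5/5! + \<dots>)\<close>.
  As a function of \<open>z\<close> it is a Lambert series minus the pole part \<open>tanh (t/2) / 2\<close>; it
  changes sign under \<open>z \<mapsto> q z\<close> and has only simple poles, at the points \<open>- q\<^sup>m\<close>. Comparing poles gives
  \<open>k'' = b k + 2 k\<^sup>3\<close> for some constant \<open>b\<close>. Hence the second derivative acts on the odd powers of \<open>k\<close>
  as a tridiagonal matrix, and expanding \<open>k\<^bsup>(2i)\<^esup>\<close> in these powers factors the Hankel matrix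
  \<open>(k\<^bsup>(2(i+j)+1)\<^esup>(0))\<close> into a lower and an upper triangular matrix with diagonals \<open>(2i)!\<close> and
  \<open>(2i+1)! k'(0)\<^bsup>2i+1\<^esup>\<close>. The determinant is therefore \<open>1! 2! \<dots> (2n-1)! k'(0)\<^bsup>n\<^sup>2\<^esup>\<close>.

  It remains to show \<open>k'(0) = - \<theta>(-q)\<^sup>4 / 4\<close>, which is Jacobi's four square theorem. The product of
  the values of \<open>k\<close> at \<open>z\<close> and \<open>-z\<close> is constant. At \<open>z = 1\<close> it is \<open>- k'(0)\<close>, and at
  \<open>z = p = \<surd>q\<close> it is \<open>Q(p) Q(-p) / 4\<close> with \<open>Q(p) = \<Sum> 2 / (p\<^sup>n + p\<^sup>-\<^sup>n)\<close>. Finally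
  \<open>Q(p) = \<theta>(p)\<^sup>2\<close> (the two square theorem), because the quotient \<open>Q(p) / \<theta>(p)\<^sup>2\<close> is unchanged when
  \<open>p\<close> is replaced by \<open>p\<^sup>2\<close> and tends to 1 as \<open>p\<close> tends to 0.
\<close>

section \<open>Hankel determinants from a differential equation\<close>

text \<open>Multiplying the equation by \<open>2 * fps_deriv f\<close> and integrating gives a first
  integral; \<open>a\<close> is the constant of integration.\<close>

lemma deriv_square_eq_of_ode:
  fixes f :: "'a::field_char_0 fps"
  assumes ode: "fps_deriv (fps_deriv f) = fps_const b * f + 2 * f ^ 3"
  obtains a where "fps_deriv f ^ 2 = fps_const a + fps_const b * f ^ 2 + f ^ 4"
proof -
  define g where "g = fps_deriv f ^ 2 - (fps_const b * f ^ 2 + f ^ 4)"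
  have "fps_deriv g = 2 * fps_deriv f * (fps_deriv (fps_deriv f) - (fps_const b * f + 2 * f ^ 3))"
    unfolding g_def fps_deriv_power power2_eq_square power3_eq_cube power4_eq_xxxx
    by (simp add: algebra_simps)
  hence "fps_deriv g = 0"
    by (simp add: ode)
  hence "g = fps_const (fps_nth g 0)"
    by (rule iffD1[OF fps_deriv_eq_0_iff])
  hence "fps_deriv f ^ 2 = fps_const (fps_nth g 0) + fps_const b * f ^ 2 + f ^ 4"
    unfolding g_def by (simp add: algebra_simps)
  thus ?thesis by (rule that)
qed

text \<open>For m = 2 k + 1, (f^m)'' = m f^(m-1) f'' + m (m-1) f^(m-2) f'^2. Substituting the
  equation and its first integral leaves only f^(m-2), f^m and f^(m+2), with coefficients m (m-1) a,
  (m + m (m-1)) b = m^2 b and 2 m + m (m-1) = m (m+1).\<close>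

lemma deriv2_odd_power:
  fixes f :: "'a::field_char_0 fps"
  assumes ode: "fps_deriv (fps_deriv f) = fps_const b * f + 2 * f ^ 3"
    and sq: "fps_deriv f ^ 2 = fps_const a + fps_const b * f ^ 2 + f ^ 4"
  shows "fps_deriv (fps_deriv (f ^ (2 * k + 1))) =
     fps_const (of_nat ((2 * k + 1) * (2 * k)) * a) * f ^ (2 * k - 1)
     + fps_const (of_nat ((2 * k + 1) ^ 2) * b) * f ^ (2 * k + 1)
     + fps_const (of_nat ((2 * k + 1) * (2 * k + 2))) * f ^ (2 * k + 3)"
proof (cases k)
  \<comment> \<open>The truncated exponent \<open>2 * k - 1\<close> is 0 here instead of -1, which
    is harmless because its coefficient contains the factor \<open>2 * k\<close>.\<close>
  case 0
  thus ?thesis by (simp add: ode power3_eq_cube)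
next
  case (Suc l)
  define N :: "'a fps" where "N = of_nat l"
  have "fps_deriv (fps_deriv (f ^ (2 * k + 1)))
      = (2 * N + 3) * (fps_deriv (fps_deriv f) * f ^ (2 * l + 2)
                        + (2 * N + 2) * (fps_deriv f ^ 2) * f ^ (2 * l + 1))"
  proof -
    have "fps_deriv (f ^ (2 * k + 1)) = of_nat (2 * k + 1) * fps_deriv f * f ^ (2 * k + 1 - 1)"
      by (rule fps_deriv_power')
    hence d1: "fps_deriv (f ^ (2 * k + 1)) = (2 * N + 3) * (fps_deriv f * f ^ (2 * l + 2))"
      by (simp add: Suc N_def algebra_simps)
    have "fps_deriv (f ^ (2 * l + 2)) = of_nat (2 * l + 2) * fps_deriv f * f ^ (2 * l + 2 - 1)"
      by (rule fps_deriv_power')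
    hence d2: "fps_deriv (f ^ (2 * l + 2)) = (2 * N + 2) * (fps_deriv f * f ^ (2 * l + 1))"
      by (simp add: N_def algebra_simps)
    have d3: "fps_deriv ((2 * N + 3) * g) = (2 * N + 3) * fps_deriv g" for g
    proof -
      have "2 * N + 3 = fps_const (of_nat (2 * l + 3))"
        unfolding fps_of_nat by (simp add: N_def)
      thus ?thesis by (simp only: fps_deriv_mult_const_left)
    qed
    have "fps_deriv (fps_deriv (f ^ (2 * k + 1)))
        = (2 * N + 3) * (fps_deriv f * fps_deriv (f ^ (2 * l + 2)) + fps_deriv (fps_deriv f) * f ^ (2 * l + 2))"
      unfolding d1 d3 by (simp only: fps_deriv_mult)
    thus ?thesis
      unfolding d2 by (simp add: power2_eq_square algebra_simps)
  qed
  also have "\<dots> = (2 * N + 3) * (2 * N + 2) * fps_const a * f ^ (2 * l + 1)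
      + (2 * N + 3) ^ 2 * fps_const b * f ^ (2 * l + 3)
      + (2 * N + 3) * (2 * N + 4) * f ^ (2 * l + 5)"
    unfolding ode sq by (simp add: algebra_simps power_add eval_nat_numeral)
  also have "\<dots> = fps_const (of_nat ((2 * k + 1) * (2 * k)) * a) * f ^ (2 * k - 1)
     + fps_const (of_nat ((2 * k + 1) ^ 2) * b) * f ^ (2 * k + 1)
     + fps_const (of_nat ((2 * k + 1) * (2 * k + 2))) * f ^ (2 * k + 3)"
  proof -
    have c: "fps_const (of_nat m * c) = of_nat m * fps_const c" for m and c :: 'a
      by (simp only: fps_of_nat[symmetric] fps_const_mult)
    have c': "fps_const (of_nat m) = (of_nat m :: 'a fps)" for m
      by (simp add: fps_of_nat)
    show ?thesis unfolding c c' Suc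
      by (simp add: N_def algebra_simps power_add eval_nat_numeral)
  qed
  finally show ?thesis .
qed

text \<open>Each further pair of derivatives raises the top odd power by two and multiplies its
  coefficient by (2 k + 1) (2 k + 2), so the factors build up a factorial. The lower coefficients
  stay unspecified: only the diagonal enters the determinant.\<close>

lemma iterated_deriv2_expansion:
  fixes f :: "'a::field_char_0 fps"
  assumes ode: "fps_deriv (fps_deriv f) = fps_const b * f + 2 * f ^ 3"
  shows "\<exists>l. (fps_deriv ^^ (2 * i)) f = (\<Sum>k\<le>i. fps_const (l k) * f ^ (2 * k + 1)) \<and> l i = fact (2 * i)"
proof -
  obtain a where sq: "fps_deriv f ^ 2 = fps_const a + fps_const b * f ^ 2 + f ^ 4"
    using deriv_square_eq_of_ode[OF ode] .
  show ?thesis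
  proof (induction i)
    case 0
    show ?case by (intro exI[of _ "\<lambda>_. 1"]) simp
  next
    case (Suc i)
    then obtain l where l: "(fps_deriv ^^ (2 * i)) f = (\<Sum>k\<le>i. fps_const (l k) * f ^ (2 * k + 1))"
      and li: "l i = fact (2 * i)" by blast
    define A where "A = (\<lambda>k. l k * (of_nat ((2 * k + 1) * (2 * k)) * a))"
    define B where "B = (\<lambda>k. l k * (of_nat ((2 * k + 1) ^ 2) * b))"
    define C where "C = (\<lambda>k. l k * of_nat ((2 * k + 1) * (2 * k + 2)))"
    \<comment> \<open>The power with index k receives contributions from index k + 1 through
      \<open>A\<close>, from k through \<open>B\<close> and from k - 1 through
      \<open>C\<close>.\<close>
    define l' where "l' = (\<lambda>k. (if Suc k \<le> i then A (Suc k) else 0) + (if k \<le> i then B k else 0)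
                            + (if k = 0 then 0 else C (k - 1)))"
    define e where "e = (\<lambda>k. f ^ (2 * k + 1))"
    have "(fps_deriv ^^ (2 * Suc i)) f = fps_deriv (fps_deriv (\<Sum>k\<le>i. fps_const (l k) * f ^ (2 * k + 1)))"
      by (simp add: l)
    also have "\<dots> = (\<Sum>k\<le>i. fps_const (l k) * fps_deriv (fps_deriv (f ^ (2 * k + 1))))"
      by (simp add: fps_deriv_sum)
    also have "\<dots> = (\<Sum>k\<le>i. fps_const (A k) * f ^ (2 * k - 1)) + (\<Sum>k\<le>i. fps_const (B k) * e k)
        + (\<Sum>k\<le>i. fps_const (C k) * e (Suc k))"
    proof -
      have "2 * Suc k + 1 = 2 * k + 3" for k by simp
      thus ?thesis
        unfolding deriv2_odd_power[OF ode sq] A_def B_def C_def e_def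
        by (simp only: sum.distrib distrib_left mult.assoc fps_const_mult[symmetric])
    qed
    \<comment> \<open>The term k = 0 drops out because \<open>A 0 = 0\<close>; the remaining indices
      are shifted down by one.\<close>
    also have "(\<Sum>k\<le>i. fps_const (A k) * f ^ (2 * k - 1)) = (\<Sum>k<i. fps_const (A (Suc k)) * e k)"
      by (subst lessThan_Suc_atMost[symmetric], subst sum.lessThan_Suc_shift) (simp add: A_def e_def)
    also have "\<dots> = (\<Sum>k\<le>Suc i. fps_const (if Suc k \<le> i then A (Suc k) else 0) * e k)"
      by (rule sum.mono_neutral_cong_left) auto
    also have "(\<Sum>k\<le>i. fps_const (B k) * e k) = (\<Sum>k\<le>Suc i. fps_const (if k \<le> i then B k else 0) * e k)"
      by (rule sum.mono_neutral_cong_left) auto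
    also have "(\<Sum>k\<le>i. fps_const (C k) * e (Suc k)) = (\<Sum>k\<le>Suc i. fps_const (if k = 0 then 0 else C (k - 1)) * e k)"
      by (subst sum.atMost_Suc_shift) simp
    finally have "(fps_deriv ^^ (2 * Suc i)) f = (\<Sum>k\<le>Suc i. fps_const (l' k) * f ^ (2 * k + 1))"
      unfolding l'_def e_def by (simp only: sum.distrib distrib_right flip: fps_const_add)
    moreover have "l' (Suc i) = fact (2 * Suc i)"
      by (simp add: l'_def C_def li algebra_simps)
    ultimately show ?case by blast
  qed
qed

lemma prod_fact_even_odd:
  "n \<ge> 1 \<Longrightarrow> (\<Prod>i<n. fact (2 * i) * fact (2 * i + 1)) = (\<Prod>r = 1..2 * n - 1. fact r :: 'a::field_char_0)"
proof (induction n rule: dec_induct)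
  case base
  show ?case by simp
next
  case (step n)
  have "{1..2 * Suc n - 1} = insert (2 * n + 1) (insert (2 * n) {1..2 * n - 1})"
    using step.hyps by auto
  moreover have "2 * n \<notin> {1..2 * n - 1}" "2 * n + 1 \<notin> insert (2 * n) {1..2 * n - 1}"
    using step.hyps by auto
  ultimately show ?case using step
    by (simp add: mult_ac)
qed

theorem hankel_det_of_ode:
  fixes f :: "'a::field_char_0 fps"
  assumes ode: "fps_deriv (fps_deriv f) = fps_const b * f + 2 * f ^ 3"
    and f0: "fps_nth f 0 = 0" and n: "n \<ge> 1"
  shows "Determinant.det (mat n n (\<lambda>(i, j). fact (2 * (i + j) + 1) * fps_nth f (2 * (i + j) + 1)))
       = (\<Prod>r = 1..2 * n - 1. fact r) * (fps_nth f 1) ^ (n ^ 2)"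
proof -
  have "\<forall>i. \<exists>l. (fps_deriv ^^ (2 * i)) f = (\<Sum>k\<le>i. fps_const (l k) * f ^ (2 * k + 1)) \<and> l i = fact (2 * i)"
    by (intro allI iterated_deriv2_expansion[OF ode])
  from choice[OF this] obtain l
    where l: "\<And>i. (fps_deriv ^^ (2 * i)) f = (\<Sum>k\<le>i. fps_const (l i k) * f ^ (2 * k + 1))"
      and ld: "\<And>i. l i i = fact (2 * i)"
    by blast
  define L where "L = mat n n (\<lambda>(i, k). if k \<le> i then l i k else 0)"
  define R where "R = mat n n (\<lambda>(k, j). fact (2 * j + 1) * fps_nth (f ^ (2 * k + 1)) (2 * j + 1))"
  have nth0: "fact m * fps_nth g m = fps_nth ((fps_deriv ^^ m) g) 0" for m and g :: "'a fps"
    by (simp add: fps_0th_higher_deriv)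
  have entry: "fact (2 * (i + j) + 1) * fps_nth f (2 * (i + j) + 1)
      = (\<Sum>k<n. (if k \<le> i then l i k else 0) * (fact (2 * j + 1) * fps_nth (f ^ (2 * k + 1)) (2 * j + 1)))"
    if "i < n" for i j
  proof -
    have "fact (2 * (i + j) + 1) * fps_nth f (2 * (i + j) + 1) = fps_nth ((fps_deriv ^^ (2 * (i + j) + 1)) f) 0"
      by (rule nth0)
    \<comment> \<open>The inner 2 i derivatives depend only on the row and are expanded in odd
      powers of f; the outer 2 j + 1 depend only on the column.\<close>
    also have "(fps_deriv ^^ (2 * (i + j) + 1)) f = (fps_deriv ^^ ((2 * j + 1) + 2 * i)) f"
      by (simp add: add_ac)
    also have "\<dots> = (fps_deriv ^^ (2 * j + 1)) ((fps_deriv ^^ (2 * i)) f)"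
      by (simp only: funpow_add o_def)
    also have "fps_nth \<dots> 0 = fact (2 * j + 1) * fps_nth ((fps_deriv ^^ (2 * i)) f) (2 * j + 1)"
      by (rule nth0[symmetric])
    also have "\<dots> = (\<Sum>k\<le>i. l i k * (fact (2 * j + 1) * fps_nth (f ^ (2 * k + 1)) (2 * j + 1)))"
      unfolding l by (simp only: fps_sum_nth sum_distrib_left fps_mult_left_const_nth mult.left_commute)
    also have "\<dots> = (\<Sum>k<n. (if k \<le> i then l i k else 0) * (fact (2 * j + 1) * fps_nth (f ^ (2 * k + 1)) (2 * j + 1)))"
      using that by (intro sum.mono_neutral_cong_left) auto
    finally show ?thesis .
  qed
  have "mat n n (\<lambda>(i, j). fact (2 * (i + j) + 1) * fps_nth f (2 * (i + j) + 1)) = L * R"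
  proof (rule eq_matI)
    fix i j assume "i < dim_row (L * R)" "j < dim_col (L * R)"
    hence ij: "i < n" "j < n" by (auto simp: L_def R_def)
    have "mat n n (\<lambda>(i, j). fact (2 * (i + j) + 1) * fps_nth f (2 * (i + j) + 1)) $$ (i, j)
        = fact (2 * (i + j) + 1) * fps_nth f (2 * (i + j) + 1)"
      using ij by simp
    also have "\<dots> = (L * R) $$ (i, j)"
      unfolding entry[OF ij(1)] using ij
      by (simp add: L_def R_def scalar_prod_def lessThan_atLeast0 del: fact_Suc power_Suc)
    finally show "mat n n (\<lambda>(i, j). fact (2 * (i + j) + 1) * fps_nth f (2 * (i + j) + 1)) $$ (i, j) = (L * R) $$ (i, j)" .
  qed (auto simp: L_def R_def)
  moreover have "Determinant.det (L * R) = Determinant.det L * Determinant.det R"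
    by (rule det_mult) (auto simp: L_def R_def)
  moreover have "Determinant.det L = (\<Prod>i<n. fact (2 * i))"
  proof -
    have "Determinant.det L = prod_list (diag_mat L)"
      by (rule det_lower_triangular[of n]) (auto simp: L_def)
    also have "\<dots> = (\<Prod>i<n. fact (2 * i))"
      by (simp add: prod_list_diag_prod L_def ld lessThan_atLeast0)
    finally show ?thesis .
  qed
  moreover have "Determinant.det R = (\<Prod>i<n. fact (2 * i + 1) * (fps_nth f 1) ^ (2 * i + 1))"
  proof -
    \<comment> \<open>Without constant term, \<open>f ^ m\<close> has order at least m, so the
      entries of \<open>R\<close> below the diagonal vanish.\<close>
    have low: "fps_nth (f ^ m) j = 0" if "j < m" for m j
      using f0 that by (rule startsby_zero_power_prefix[rule_format])
    have "Determinant.det R = prod_list (diag_mat R)"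
      by (rule det_upper_triangular[of _ n]) (auto simp: R_def low simp del: power_Suc fact_Suc)
    also have "\<dots> = (\<Prod>i<n. fact (2 * i + 1) * (fps_nth f 1) ^ (2 * i + 1))"
      by (simp add: prod_list_diag_prod R_def lessThan_atLeast0 startsby_zero_power_nth_same[OF f0] del: fact_Suc power_Suc)
    finally show ?thesis .
  qed
  \<comment> \<open>The exponents are the first n odd numbers, whose sum is n^2.\<close>
  moreover have "(\<Prod>i<n. (fps_nth f 1) ^ (2 * i + 1)) = (fps_nth f 1) ^ (n ^ 2)"
  proof -
    have "(\<Sum>i<n. 2 * i + 1) = n ^ 2"
      by (induction n) (auto simp: power2_eq_square)
    thus ?thesis by (simp only: power_sum[symmetric])
  qed
  ultimately show ?thesis
    unfolding prod_fact_even_odd[OF n, symmetric]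
    by (simp only: prod.distrib mult_ac)
qed

section \<open>Bernoulli numbers and the logistic function\<close>

text \<open>This is 1 / (e^t + 1) = 1 / (e^t - 1) - 2 / (e^(2 t) - 1) multiplied by t.
  \<open>B\<close> stands for t / (e^t - 1), and the rescaled series is \<open>B\<close> at 2
  t.\<close>

lemma fps_X_times_inverse_exp_plus_one:
  fixes B :: "'a::field_char_0 fps"
  assumes B: "B * (fps_exp 1 - 1) = fps_X"
  shows "fps_X * inverse (1 + fps_exp 1) = B - Abs_fps (\<lambda>n. 2 ^ n * fps_nth B n)"
proof -
  define E :: "'a fps" where "E = fps_exp 1"
  define C where "C = Abs_fps (\<lambda>n. 2 ^ n * fps_nth B n)"
  define L :: "'a fps" where "L = fps_const 2 * fps_X"
  have L0: "fps_nth L 0 = 0"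
    by (simp add: L_def)
  have C: "C = fps_compose B L"
    by (simp add: C_def L_def fps_compose_linear)
  have EE: "fps_compose E L = E * E"
    using fps_exp_add_mult[of 1 "1 :: 'a"] by (simp add: E_def L_def)
  have "C * (E * E - 1) = fps_compose (B * (E - 1)) L"
    unfolding C fps_compose_mult_distrib[OF L0] fps_compose_sub_distrib EE by simp
  also have "\<dots> = 2 * fps_X"
    using B L0 by (simp add: E_def L_def numeral_fps_const)
  finally have C2: "C * (E * E - 1) = 2 * fps_X" .
  have "((B - C) * (1 + E)) * (E - 1) = (B * (E - 1)) * (1 + E) - C * (E * E - 1)"
    by (simp add: algebra_simps)
  also have "\<dots> = fps_X * (E - 1)"
    using B unfolding C2 by (simp add: E_def algebra_simps)
  finally have "((B - C) * (1 + E)) * (E - 1) = fps_X * (E - 1)" .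
  moreover have "E - 1 \<noteq> 0"
    using B by (auto simp: E_def)
  ultimately have "(B - C) * (1 + E) = fps_X"
    by simp
  hence "(B - C) * ((1 + E) * inverse (1 + E)) = fps_X * inverse (1 + E)"
    by (metis mult.assoc)
  also have "(1 + E) * inverse (1 + E) = 1"
    by (subst mult.commute, rule inverse_mult_eq_1) (simp add: E_def)
  finally show ?thesis
    by (simp add: C_def E_def)
qed

text \<open>The series of - tanh (t / 2) / 2. Subtracting 1 / 2 makes it odd.\<close>

definition logistic_fps :: "'a::field_char_0 fps" where
  "logistic_fps = inverse (1 + fps_exp 1) - fps_const (1 / 2)"

lemma logistic_fps_nth:
  fixes B :: "'a::field_char_0 fps"
  assumes B: "B * (fps_exp 1 - 1) = fps_X" and m: "m \<ge> 1"
  shows "fps_nth logistic_fps m = (1 - 2 ^ Suc m) * fps_nth B (Suc m)"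
proof -
  have "fps_nth (inverse (1 + fps_exp 1) :: 'a fps) m = fps_nth (fps_X * inverse (1 + fps_exp 1)) (Suc m)"
    by simp
  also have "\<dots> = fps_nth B (Suc m) - 2 ^ Suc m * fps_nth B (Suc m)"
    unfolding fps_X_times_inverse_exp_plus_one[OF B] by simp
  finally show ?thesis
    using m by (simp add: logistic_fps_def algebra_simps)
qed

text \<open>The function u = 1 / (1 + e^t) satisfies u' = u^2 - u, and the shift by 1 / 2 completes
  the square.\<close>

lemma logistic_fps_deriv: "fps_deriv logistic_fps = logistic_fps ^ 2 - fps_const (1 / 4 :: 'a::field_char_0)"
proof -
  define E :: "'a fps" where "E = fps_exp 1"
  have i: "(1 + E) * inverse (1 + E) = 1"
    by (subst mult.commute, rule inverse_mult_eq_1) (simp add: E_def)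
  have "fps_deriv (logistic_fps :: 'a fps) = - E * inverse (1 + E) ^ 2"
    unfolding logistic_fps_def E_def[symmetric]
    by (simp add: fps_inverse_deriv E_def)
  also have "\<dots> = inverse (1 + E) ^ 2 - ((1 + E) * inverse (1 + E)) * inverse (1 + E)"
    by (simp add: power2_eq_square algebra_simps)
  also have "\<dots> = inverse (1 + E) ^ 2 - inverse (1 + E)"
    by (simp add: i)
  also have "\<dots> = logistic_fps ^ 2 - fps_const (1 / 4)"
  proof -
    have "(inverse (1 + E) - fps_const (1 / 2)) ^ 2
        = inverse (1 + E) ^ 2 - (fps_const (1 / 2) + fps_const (1 / 2)) * inverse (1 + E)
          + fps_const (1 / 2) * fps_const (1 / 2)"
      by (simp only: power2_eq_square algebra_simps)
    thus ?thesis
      by (simp add: logistic_fps_def E_def del: fps_const_add add: fps_const_add)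
  qed
  finally show ?thesis .
qed

text \<open>Comparing coefficients in the Riccati equation gives a quadratic recursion. Products
  with an even index vanish, and the alternating signs of two odd indices combine to the required
  one. The signs of the Bernoulli numbers follow from this.\<close>

lemma logistic_fps_sign:
  "(even n \<longrightarrow> fps_nth (logistic_fps :: real fps) n = 0) \<and>
   (\<forall>j. n = 2 * j + 1 \<longrightarrow> (-1) ^ Suc j * fps_nth (logistic_fps :: real fps) n \<ge> 0)"
proof (induction n rule: less_induct)
  case (less n)
  let ?W = "logistic_fps :: real fps"
  show ?case
  proof (cases n)
    case 0
    thus ?thesis by (simp add: logistic_fps_def)
  next
    case (Suc m)
    have rec: "real (Suc m) * fps_nth ?W (Suc m)
        = (\<Sum>i\<le>m. fps_nth ?W i * fps_nth ?W (m - i)) - (if m = 0 then 1 / 4 else 0)"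
    proof -
      have "real (Suc m) * fps_nth ?W (Suc m) = fps_nth (fps_deriv ?W) m"
        by simp
      thus ?thesis
        unfolding logistic_fps_deriv by (simp add: power2_eq_square fps_mult_nth atLeast0AtMost)
    qed
    have ev: "fps_nth ?W i = 0" if "i \<le> m" "even i" for i
      using less.IH[of i] that Suc by auto
    have od: "(-1) ^ Suc j * fps_nth ?W (2 * j + 1) \<ge> 0" if "2 * j + 1 \<le> m" for j
      using less.IH[of "2 * j + 1"] that Suc by auto
    have "fps_nth ?W n = 0" if "even n"
    proof -
      have "(\<Sum>i\<le>m. fps_nth ?W i * fps_nth ?W (m - i)) = 0"
      proof (intro sum.neutral ballI)
        fix i assume i: "i \<in> {..m}"
        have "even i \<or> even (m - i)"
          using that i Suc by auto
        thus "fps_nth ?W i * fps_nth ?W (m - i) = 0"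
          using ev[of i] ev[of "m - i"] i by auto
      qed
      moreover have "m \<noteq> 0"
        using that Suc by (intro notI) auto
      ultimately show ?thesis
        using rec Suc by simp
    qed
    moreover have "(-1) ^ Suc j * fps_nth ?W n \<ge> 0" if j: "n = 2 * j + 1" for j
    proof (cases "m = 0")
      case True
      with rec j Suc show ?thesis by (simp add: logistic_fps_def)
    next
      case False
      have "0 \<le> (\<Sum>i\<le>m. (-1) ^ Suc j * (fps_nth ?W i * fps_nth ?W (m - i)))"
      proof (intro sum_nonneg)
        fix i assume i: "i \<in> {..m}"
        show "0 \<le> (-1) ^ Suc j * (fps_nth ?W i * fps_nth ?W (m - i))"
        proof (cases "even i")
          case True
          thus ?thesis using ev[of i] i by simp
        next
          case False
          then obtain a where a: "i = 2 * a + 1" by (elim oddE)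
          have "a < j" using a i j Suc by simp
          \<comment> \<open>The odd indices are 2 a + 1 and 2 b + 1 with a + b = j - 1, so the signs
            (-1)^(a+1) and (-1)^(b+1) multiply to (-1)^(j+1).\<close>
          define b where "b = j - 1 - a"
          have b: "m - i = 2 * b + 1" and jab: "j = a + b + 1"
            using \<open>a < j\<close> a j Suc by (auto simp: b_def)
          have "0 \<le> ((-1) ^ Suc a * fps_nth ?W i) * ((-1) ^ Suc b * fps_nth ?W (m - i))"
          proof (rule mult_nonneg_nonneg)
            show "0 \<le> (-1) ^ Suc a * fps_nth ?W i"
              using od[of a] a i by simp
            have "m - i \<le> m" by simp
            hence "2 * b + 1 \<le> m" unfolding b .
            from od[OF this] show "0 \<le> (-1) ^ Suc b * fps_nth ?W (m - i)"
              unfolding b .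
          qed
          also have "\<dots> = (-1) ^ Suc j * (fps_nth ?W i * fps_nth ?W (m - i))"
            by (simp add: jab power_add)
          finally show ?thesis .
        qed
      qed
      also have "\<dots> = (-1) ^ Suc j * (real (Suc m) * fps_nth ?W n)"
        using rec False Suc by (simp only: sum_distrib_left[symmetric] if_False diff_zero)
      also have "\<dots> = real (Suc m) * ((-1) ^ Suc j * fps_nth ?W n)"
        by (rule mult.left_commute)
      finally show ?thesis
        by (subst (asm) zero_le_mult_iff) simp
    qed
    ultimately show ?thesis by blast
  qed
qed

text \<open>The factor 1 - 2^(2 i) between the logistic coefficient and the Bernoulli one is
  negative, so the sign pattern of the logistic series carries over reversed.\<close>

lemma abs_bernoulli_even:
  assumes "i \<ge> 1"
  shows "\<bar>bernoulli (2 * i)\<bar> = (-1) ^ (i - 1) * bernoulli (2 * i)"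
proof -
  define F :: "real fps" where "F = fps_X / (fps_exp 1 - 1)"
  have sd: "subdegree (fps_exp 1 - 1 :: real fps) = 1"
    by (rule subdegreeI) auto
  have "fps_exp 1 - 1 dvd (fps_X :: real fps)"
    using sd by (subst fps_dvd_iff) auto
  hence F: "F * (fps_exp 1 - 1) = fps_X"
    by (simp add: F_def)
  obtain j where j: "i = Suc j"
    using assms by (cases i) auto
  have "0 \<le> (-1) ^ Suc j * fps_nth (logistic_fps :: real fps) (2 * j + 1)"
    using logistic_fps_sign[of "2 * j + 1"] by blast
  also have "\<dots> = (2 ^ (2 * i) - 1) * ((-1) ^ j * fps_nth F (2 * i))"
    by (subst logistic_fps_nth[OF F]) (simp_all add: j algebra_simps)
  finally have "0 \<le> (2 ^ (2 * i) - 1) * ((-1) ^ j * fps_nth F (2 * i))" .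
  moreover have "0 < 2 ^ (2 * i) - (1 :: real)"
    using assms by (simp add: one_less_power)
  ultimately have "0 \<le> (-1) ^ j * fps_nth F (2 * i)"
    by (metis mult_less_0_iff not_less)
  hence "0 \<le> fact (2 * i) * ((-1) ^ j * fps_nth F (2 * i))"
    by (rule mult_nonneg_nonneg[OF fact_ge_zero])
  hence nn: "0 \<le> (-1) ^ j * bernoulli (2 * i)"
    by (simp add: bernoulli_def F_def mult_ac del: fact_Suc)
  have "\<bar>bernoulli (2 * i)\<bar> = \<bar>(-1) ^ j * bernoulli (2 * i)\<bar>"
    by (simp add: abs_mult power_abs)
  thus ?thesis using nn j by simp
qed

text \<open>The sign in \<open>c_coeff\<close> cancels that of the Bernoulli number inside the
  absolute value, and (2 i)! = 2 i (2 i - 1)! accounts for the denominator. The pole part therefore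
  supplies the summand -c_i of g_i.\<close>

lemma logistic_fps_c_coeff:
  assumes "i \<ge> 1"
  shows "fact (2 * i - 1) * fps_nth logistic_fps (2 * i - 1) = - 2 * complex_of_real (c_coeff i)"
proof -
  obtain j where j: "i = Suc j"
    using assms by (cases i) auto
  have "c_coeff i = (2 ^ (2 * i) - 1) / (4 * real i) * bernoulli (2 * i)"
    unfolding c_coeff_def abs_bernoulli_even[OF assms]
    by (simp add: j mult_ac flip: power_add)
  hence "complex_of_real (c_coeff i) = (2 ^ (2 * i) - 1) / (4 * of_nat i) * of_real (bernoulli (2 * i))"
    by simp
  hence "- 2 * complex_of_real (c_coeff i)
      = (1 - 2 ^ (2 * i)) * (of_real (bernoulli (2 * i)) / (2 * of_nat i))"
    using j by (simp add: field_simps del: of_nat_Suc)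
  also have "\<dots> = fact (2 * i - 1) * ((1 - 2 ^ (2 * i)) * (of_real (bernoulli (2 * i)) / fact (2 * i)))"
  proof -
    have "(fact (2 * i) :: complex) = (2 * of_nat i) * fact (2 * i - 1)"
      using assms by (subst fact_reduce) auto
    thus ?thesis by simp
  qed
  also have "(1 - 2 ^ (2 * i)) * (of_real (bernoulli (2 * i)) / fact (2 * i)) = (fps_nth logistic_fps (2 * i - 1) :: complex)"
    using assms by (subst logistic_fps_nth[OF bernoulli_fps_mult]) auto
  finally show ?thesis by simp
qed

section \<open>Bilateral sums and the two square theorem\<close>

lemma summable_on_int_dominated:
  fixes f :: "int \<Rightarrow> complex"
  assumes x: "0 \<le> x" "x < 1" and bound: "\<And>n. norm (f n) \<le> C * x ^ nat \<bar>n\<bar>"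
  shows "(\<lambda>n. norm (f n)) summable_on UNIV"
proof -
  have g: "(\<lambda>n::nat. x ^ n) summable_on A" for A
  proof -
    have "(\<lambda>n::nat. x ^ n) summable_on UNIV"
      using x by (intro norm_summable_imp_summable_on) (auto simp: norm_power)
    thus ?thesis by (rule summable_on_subset_banach) auto
  qed
  have "bij_betw int UNIV {0..}"
    by (rule bij_betwI[of _ _ _ nat]) auto
  hence "(\<lambda>n::int. x ^ nat \<bar>n\<bar>) summable_on {0..}"
    by (subst summable_on_reindex_bij_betw[of int UNIV, symmetric]) (simp_all add: g)
  moreover have "(\<lambda>n::int. x ^ nat \<bar>n\<bar>) summable_on {..<0}"
    by (subst summable_on_reindex_bij_betw[of "\<lambda>n. - int n" "{1..}", symmetric])
       (auto simp: g intro!: bij_betwI[of _ _ _ "\<lambda>n. nat (- n)"])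
  ultimately have "(\<lambda>n::int. x ^ nat \<bar>n\<bar>) summable_on ({0..} \<union> {..<0})"
    by (rule summable_on_union)
  moreover have "{0..} \<union> {..<0} = (UNIV :: int set)" by auto
  ultimately have "(\<lambda>n::int. C * x ^ nat \<bar>n\<bar>) summable_on UNIV"
    by (intro summable_on_cmult_right) simp
  thus ?thesis
    by (rule Infinite_Sum.abs_summable_on_comparison_test') (use bound in auto)
qed

lemma infsum_int_split:
  fixes f :: "int \<Rightarrow> complex"
  assumes f: "(\<lambda>n. norm (f n)) summable_on UNIV" and even: "\<And>n. f (- n) = f n"
  shows "infsum f UNIV = f 0 + 2 * (\<Sum>n. f (int (Suc n)))"
proof -
  have s: "f summable_on A" for A
    using abs_summable_summable[OF f] by (rule summable_on_subset_banach) auto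
  have U: "UNIV = insert 0 ({1..} \<union> {..-1::int})" by auto
  have "infsum f UNIV = f 0 + infsum f ({1..} \<union> {..-1})"
    by (subst U, subst infsum_insert) (auto simp: s)
  also have "infsum f ({1..} \<union> {..-1}) = infsum f {1..} + infsum f {..-1}"
    by (rule infsum_Un_disjoint) (auto simp: s)
  also have "infsum f {..-1} = infsum f {1..}"
    by (subst infsum_reindex_bij_betw[of uminus "{1..}", symmetric])
       (auto simp: even intro!: bij_betwI[of _ _ _ uminus])
  also have "infsum f {1..} = infsum (\<lambda>n. f (int (Suc n))) UNIV"
    by (rule infsum_reindex_bij_betw[symmetric]) (auto intro!: bij_betwI[of _ _ _ "\<lambda>n. nat (n - 1)"])
  also have "\<dots> = (\<Sum>n. f (int (Suc n)))"
  proof -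
    have "(\<lambda>n. f (int (Suc n))) summable_on UNIV"
      by (subst summable_on_reindex_bij_betw[of "\<lambda>n. int (Suc n)" UNIV "{1..}"])
         (auto simp: s intro!: bij_betwI[of _ _ _ "\<lambda>n. nat (n - 1)"])
    hence "((\<lambda>n. f (int (Suc n))) has_sum infsum (\<lambda>n. f (int (Suc n))) UNIV) UNIV"
      by (rule has_sum_infsum)
    thus ?thesis
      by (intro sums_unique has_sum_imp_sums)
  qed
  finally show ?thesis by simp
qed

text \<open>The exponent n^2 - k n is at least |n| minus a constant depending on k, so series with
  such exponents are dominated by a geometric series.\<close>

lemma powi_quadratic_bound:
  fixes p :: complex
  assumes p: "p \<noteq> 0" "norm p < 1"
  shows "norm (p powi (n ^ 2 - k * n)) \<le> norm p powi (- ((\<bar>k\<bar> + 1) ^ 2)) * norm p ^ nat \<bar>n\<bar>"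
proof -
  have "\<bar>n\<bar> - (\<bar>k\<bar> + 1) ^ 2 \<le> n ^ 2 - k * n"
  proof -
    have "k * n \<le> \<bar>k\<bar> * \<bar>n\<bar>"
      by (metis abs_ge_self abs_mult)
    moreover have "(\<bar>k\<bar> + 1) * \<bar>n\<bar> \<le> n ^ 2 + (\<bar>k\<bar> + 1) ^ 2"
    proof -
      \<comment> \<open>The added term reduces the mixed term of the square from twice (|k| + 1) |n|
        to once.\<close>
      have "0 \<le> (\<bar>n\<bar> - (\<bar>k\<bar> + 1)) ^ 2 + (\<bar>k\<bar> + 1) * \<bar>n\<bar>" by simp
      thus ?thesis by (simp add: power2_eq_square algebra_simps)
    qed
    ultimately show ?thesis by (simp add: algebra_simps)
  qed
  hence "norm p powi (n ^ 2 - k * n) \<le> norm p powi (\<bar>n\<bar> - (\<bar>k\<bar> + 1) ^ 2)"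
    using p by (intro power_int_decreasing) auto
  also have "\<dots> = norm p powi (- ((\<bar>k\<bar> + 1) ^ 2)) * norm p powi \<bar>n\<bar>"
    using p by (subst power_int_add[symmetric]) auto
  also have "norm p powi \<bar>n\<bar> = norm p ^ nat \<bar>n\<bar>"
    by (simp add: power_int_def)
  finally show ?thesis
    by (simp add: norm_power_int)
qed

lemma powi_quadratic_abs_summable:
  fixes p :: complex
  assumes p: "p \<noteq> 0" "norm p < 1" and g: "\<And>n. norm (g n) \<le> 1"
  shows "(\<lambda>n::int. norm (g n * p powi (n ^ 2 - k * n))) summable_on UNIV"
proof (rule summable_on_int_dominated)
  show "norm (g n * p powi (n ^ 2 - k * n)) \<le> norm p powi (- ((\<bar>k\<bar> + 1) ^ 2)) * norm p ^ nat \<bar>n\<bar>" for n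
    using mult_mono[OF g powi_quadratic_bound[OF p]] by (simp add: norm_mult)
qed (use p in auto)

abbreviation sgi :: "int \<Rightarrow> complex" where "sgi n \<equiv> (-1) powi n"

text \<open>The integers n and n^2 have the same parity.\<close>

lemma powi_neg_square: "(- p) powi (n ^ 2) = (-1) powi n * (p :: complex) powi (n ^ 2)"
proof -
  have "(- p) powi (n ^ 2) = (-1 * p) powi (n ^ 2)" by simp
  also have "\<dots> = (-1) powi (n ^ 2) * p powi (n ^ 2)"
    by (rule power_int_mult_distrib)
  also have "(-1) powi (n ^ 2) = ((-1) powi n :: complex)"
    by (cases "even n") (auto simp: power_int_minus_left)
  finally show ?thesis .
qed

lemma theta_abs_summable:
  fixes p :: complex
  assumes "p \<noteq> 0" "norm p < 1"
  shows "(\<lambda>n::int. norm (p powi (n ^ 2))) summable_on UNIV"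
  using powi_quadratic_abs_summable[OF assms, of "\<lambda>_. 1" 0] by simp

lemma infsum_mult_infsum:
  fixes f :: "'a \<Rightarrow> complex" and g :: "'b \<Rightarrow> complex"
  assumes f: "(\<lambda>x. norm (f x)) summable_on A" and g: "(\<lambda>x. norm (g x)) summable_on B"
  shows "(\<lambda>(x, y). f x * g y) summable_on A \<times> B"
    and "infsum f A * infsum g B = (\<Sum>\<^sub>\<infinity>(x, y)\<in>A \<times> B. f x * g y)"
proof -
  have "(\<lambda>z. norm (case z of (x, y) \<Rightarrow> f x * g y)) summable_on A \<times> B"
  proof (subst Infinite_Sum.abs_summable_on_Sigma_iff, intro conjI ballI)
    show "(\<lambda>y. norm (case (x, y) of (x, y) \<Rightarrow> f x * g y)) summable_on B" for x
      by (simp add: norm_mult summable_on_cmult_right[OF g])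
    have "(\<lambda>x. norm (f x) * (\<Sum>\<^sub>\<infinity>y\<in>B. norm (g y))) summable_on A"
      by (rule summable_on_cmult_left[OF f])
    thus "(\<lambda>x. norm (\<Sum>\<^sub>\<infinity>y\<in>B. norm (case (x, y) of (x, y) \<Rightarrow> f x * g y))) summable_on A"
      by (simp add: norm_mult infsum_cmult_right' infsum_nonneg)
  qed
  thus s: "(\<lambda>(x, y). f x * g y) summable_on A \<times> B"
    by (rule abs_summable_summable)
  show "infsum f A * infsum g B = (\<Sum>\<^sub>\<infinity>(x, y)\<in>A \<times> B. f x * g y)"
    by (subst infsum_Sigma'_banach[symmetric, OF s]) (simp add: infsum_cmult_right' infsum_cmult_left')
qed

section \<open>Theta values and their quadratic identities\<close>

lemma signed_theta_eq: "theta3_0 (- p) = (\<Sum>\<^sub>\<infinity>j::int. sgi j * p powi (j ^ 2))"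
  unfolding theta3_0_def powi_neg_square ..

lemma signed_theta_abs_summable:
  fixes p :: complex
  assumes "p \<noteq> 0" "norm p < 1"
  shows "(\<lambda>n::int. norm (sgi n * p powi (n ^ 2))) summable_on UNIV"
  using theta_abs_summable[OF assms] by (simp add: norm_mult norm_power_int)

lemma norm_sgi: "norm (sgi n) = 1"
  by (simp add: norm_power_int)

lemma sgi_add: "sgi (m + n) = sgi m * sgi n"
  by (rule power_int_add) auto

lemma sgi_diff: "sgi (m - n) = sgi m * sgi n"
  by (cases "even m"; cases "even n") (auto simp: power_int_minus_left)

lemma sgi_even: "even n \<Longrightarrow> sgi n = 1" and sgi_odd: "odd n \<Longrightarrow> sgi n = -1"
  by (auto simp: power_int_minus_left)

text \<open>The change of variables \<open>(j, k) = (m + l, m - l)\<close>, which turns \<open>j\<^sup>2 + k\<^sup>2\<close> into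
  \<open>2 m\<^sup>2 + 2 l\<^sup>2\<close>.\<close>

lemma infsum_rotate_lattice:
  fixes p :: complex
  assumes p: "p \<noteq> 0" and c: "\<And>j k. odd (j + k) \<Longrightarrow> c j k = 0"
  shows "(\<Sum>\<^sub>\<infinity>(j::int, k::int)\<in>UNIV \<times> UNIV. c j k * (p powi (j ^ 2) * p powi (k ^ 2)))
       = (\<Sum>\<^sub>\<infinity>(m::int, l::int)\<in>UNIV \<times> UNIV. c (m + l) (m - l) * ((p ^ 2) powi (m ^ 2) * (p ^ 2) powi (l ^ 2)))"
proof -
  let ?F = "\<lambda>(j, k). c j k * (p powi (j ^ 2) * p powi (k ^ 2))"
  let ?r = "\<lambda>(m::int, l::int). (m + l, m - l)"
  have "infsum ?F (UNIV \<times> UNIV) = infsum ?F {(j, k). even (j + k)}"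
    by (rule infsum_cong_neutral) (use c in fastforce)+
  also have "\<dots> = infsum (\<lambda>z. ?F (?r z)) (UNIV \<times> UNIV)"
  proof (rule infsum_reindex_bij_betw[symmetric])
    show "bij_betw ?r (UNIV \<times> UNIV) {(j, k). even (j + k)}"
      by (rule bij_betwI[of _ _ _ "\<lambda>(j, k). ((j + k) div 2, (j - k) div 2)"]) (auto, presburger+)
  qed
  also have "\<dots> = (\<Sum>\<^sub>\<infinity>(m::int, l::int)\<in>UNIV \<times> UNIV. c (m + l) (m - l) * ((p ^ 2) powi (m ^ 2) * (p ^ 2) powi (l ^ 2)))"
  proof (rule infsum_cong, clarify)
    fix m l :: int
    have "p powi ((m + l) ^ 2) * p powi ((m - l) ^ 2) = p powi (2 * m ^ 2 + 2 * l ^ 2)"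
      using p by (subst power_int_add[symmetric]) (auto simp: power2_eq_square algebra_simps)
    also have "\<dots> = (p ^ 2) powi (m ^ 2) * (p ^ 2) powi (l ^ 2)"
      using p by (simp add: power_int_add power_int_mult)
    finally show "c (m + l) (m - l) * (p powi ((m + l) ^ 2) * p powi ((m - l) ^ 2))
        = c (m + l) (m - l) * ((p ^ 2) powi (m ^ 2) * (p ^ 2) powi (l ^ 2))" by simp
  qed
  finally show ?thesis .
qed

text \<open>In the sum of the two double series the weight 1 + (-1)^(j+k) kills the pairs with j + k
  odd and doubles the others, which the rotated lattice parametrises.\<close>

lemma theta3_0_square_sum:
  assumes p: "p \<noteq> 0" "norm p < 1"
  shows "theta3_0 p ^ 2 + theta3_0 (- p) ^ 2 = 2 * theta3_0 (p ^ 2) ^ 2"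
proof -
  have p2: "p ^ 2 \<noteq> 0" "norm (p ^ 2) < 1"
    using p by (auto simp: norm_power power_less_one_iff)
  note th = infsum_mult_infsum[OF theta_abs_summable[OF p] theta_abs_summable[OF p]]
  note sth = infsum_mult_infsum[OF signed_theta_abs_summable[OF p] signed_theta_abs_summable[OF p]]
  have "theta3_0 p ^ 2 + theta3_0 (- p) ^ 2
      = (\<Sum>\<^sub>\<infinity>(j, k)\<in>UNIV \<times> UNIV. p powi (j ^ 2) * p powi (k ^ 2))
        + (\<Sum>\<^sub>\<infinity>(j, k)\<in>UNIV \<times> UNIV. (sgi j * p powi (j ^ 2)) * (sgi k * p powi (k ^ 2)))"
    unfolding signed_theta_eq unfolding theta3_0_def power2_eq_square[of "infsum _ _"] th(2) sth(2) ..
  also have "\<dots> = (\<Sum>\<^sub>\<infinity>(j, k)\<in>UNIV \<times> UNIV. (1 + sgi (j + k)) * (p powi (j ^ 2) * p powi (k ^ 2)))"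
    by (subst infsum_add[symmetric, OF th(1) sth(1)]) (auto intro!: infsum_cong simp: sgi_add algebra_simps)
  also have "\<dots> = (\<Sum>\<^sub>\<infinity>(m, l)\<in>UNIV \<times> UNIV. (1 + sgi ((m + l) + (m - l))) * ((p ^ 2) powi (m ^ 2) * (p ^ 2) powi (l ^ 2)))"
    using p by (intro infsum_rotate_lattice) (auto simp: sgi_odd)
  also have "\<dots> = (\<Sum>\<^sub>\<infinity>z\<in>UNIV \<times> UNIV. 2 * (case z of (m, l) \<Rightarrow> (p ^ 2) powi (m ^ 2) * (p ^ 2) powi (l ^ 2)))"
    by (intro infsum_cong) (auto simp: sgi_even)
  also have "\<dots> = 2 * (\<Sum>\<^sub>\<infinity>(m, l)\<in>UNIV \<times> UNIV. (p ^ 2) powi (m ^ 2) * (p ^ 2) powi (l ^ 2))"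
    by (rule infsum_cmult_right')
  also have "\<dots> = 2 * theta3_0 (p ^ 2) ^ 2"
    unfolding infsum_mult_infsum(2)[OF theta_abs_summable[OF p2] theta_abs_summable[OF p2], symmetric]
    by (simp add: theta3_0_def power2_eq_square)
  finally show ?thesis .
qed

text \<open>The product is taken in both orders, so that the weight (-1)^j + (-1)^k vanishes when j
  + k is odd. At j = m + l, k = m - l it equals 2 (-1)^m (-1)^l, which separates the variables
  again.\<close>

lemma theta3_0_times_minus:
  assumes p: "p \<noteq> 0" "norm p < 1"
  shows "theta3_0 p * theta3_0 (- p) = theta3_0 (- (p ^ 2)) ^ 2"
proof -
  have p2: "p ^ 2 \<noteq> 0" "norm (p ^ 2) < 1"
    using p by (auto simp: norm_power power_less_one_iff)
  note a = infsum_mult_infsum[OF theta_abs_summable[OF p] signed_theta_abs_summable[OF p]]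
  note b = infsum_mult_infsum[OF signed_theta_abs_summable[OF p] theta_abs_summable[OF p]]
  have "2 * (theta3_0 p * theta3_0 (- p)) = theta3_0 p * theta3_0 (- p) + theta3_0 (- p) * theta3_0 p"
    by simp
  also have "\<dots> = (\<Sum>\<^sub>\<infinity>(j, k)\<in>UNIV \<times> UNIV. p powi (j ^ 2) * (sgi k * p powi (k ^ 2)))
        + (\<Sum>\<^sub>\<infinity>(j, k)\<in>UNIV \<times> UNIV. (sgi j * p powi (j ^ 2)) * p powi (k ^ 2))"
    unfolding signed_theta_eq unfolding theta3_0_def a(2) b(2) ..
  also have "\<dots> = (\<Sum>\<^sub>\<infinity>(j, k)\<in>UNIV \<times> UNIV. (sgi j + sgi k) * (p powi (j ^ 2) * p powi (k ^ 2)))"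
    by (subst infsum_add[symmetric, OF a(1) b(1)]) (auto intro!: infsum_cong simp: algebra_simps)
  also have "\<dots> = (\<Sum>\<^sub>\<infinity>(m, l)\<in>UNIV \<times> UNIV. (sgi (m + l) + sgi (m - l)) * ((p ^ 2) powi (m ^ 2) * (p ^ 2) powi (l ^ 2)))"
    using p by (intro infsum_rotate_lattice) (auto simp: sgi_odd sgi_even)
  also have "\<dots> = (\<Sum>\<^sub>\<infinity>z\<in>UNIV \<times> UNIV. 2 * (case z of (m, l) \<Rightarrow> (sgi m * (p ^ 2) powi (m ^ 2)) * (sgi l * (p ^ 2) powi (l ^ 2))))"
    by (intro infsum_cong) (auto simp: sgi_add sgi_diff)
  also have "\<dots> = 2 * (\<Sum>\<^sub>\<infinity>(m, l)\<in>UNIV \<times> UNIV. (sgi m * (p ^ 2) powi (m ^ 2)) * (sgi l * (p ^ 2) powi (l ^ 2)))"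
    by (rule infsum_cmult_right')
  also have "\<dots> = 2 * theta3_0 (- (p ^ 2)) ^ 2"
    unfolding infsum_mult_infsum(2)[OF signed_theta_abs_summable[OF p2] signed_theta_abs_summable[OF p2], symmetric]
    by (simp add: signed_theta_eq power2_eq_square)
  finally show ?thesis by simp
qed

section \<open>Sums of sech (n s), where p = exp (- s)\<close>

definition sech_sum :: "complex \<Rightarrow> complex" where
  "sech_sum p = 2 * (\<Sum>\<^sub>\<infinity>n::int. p powi n / (1 + p powi (2 * n)))"

text \<open>The coefficient of z^0 in the product of the Fourier series with coefficients p^n / (1 +
  p^(2 n)) and (-1)^n p^(n^2).\<close>

definition sech_theta_coeff :: "complex \<Rightarrow> complex" where
  "sech_theta_coeff p = (\<Sum>\<^sub>\<infinity>n::int. sgi n * (p powi n / (1 + p powi (2 * n))) * p powi (n ^ 2))"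

context
  fixes p :: complex
  assumes p: "p \<noteq> 0" "norm p < 1"
begin

lemma one_plus_powi_neq_0: "n \<noteq> 0 \<Longrightarrow> 1 + p powi n \<noteq> 0"
proof
  assume n: "n \<noteq> 0" and "1 + p powi n = 0"
  hence "p powi n = -1"
    by (metis add_eq_0_iff)
  hence "norm p powi n = 1"
    by (metis norm_minus_cancel norm_one norm_power_int)
  moreover have "norm p powi n < 1 \<or> norm p powi n > 1"
  proof (cases "n > 0")
    case True
    thus ?thesis using p n by (simp add: power_int_def power_less_one_iff)
  next
    case False
    thus ?thesis using p n by (simp add: power_int_def one_less_inverse_iff power_less_one_iff flip: power_inverse)
  qed
  ultimately show False by auto
qed

lemma one_plus_powi_neq_0': "1 + p powi n \<noteq> 0"
  by (cases "n = 0") (auto simp: one_plus_powi_neq_0)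

lemma sech_term_even: "p powi (- n) / (1 + p powi (2 * - n)) = p powi n / (1 + p powi (2 * n))"
proof -
  define y where "y = p powi n"
  have y: "y \<noteq> 0" using p by (simp add: y_def)
  have e: "p powi (2 * n) = y ^ 2" 
    by (simp add: y_def power_int_mult mult.commute[of 2])
  have e1: "p powi (2 * - n) = inverse (y ^ 2)" 
    using e by (simp add: power_int_minus)
  have e2: "p powi (- n) = inverse y" by (simp add: y_def power_int_minus)
  have "1 + y ^ 2 \<noteq> 0"
    using one_plus_powi_neq_0'[of "2 * n"] e by simp
  thus ?thesis unfolding e1 e2 unfolding e unfolding y_def[symmetric] using y
    by (simp add: field_simps power2_eq_square)
qed

text \<open>The term is even in n, and for n nonnegative its denominator has modulus at least 1 -
  |p|.\<close>

lemma sech_term_bound: "norm (p powi n / (1 + p powi (2 * n))) \<le> inverse (1 - norm p) * norm p ^ nat \<bar>n\<bar>"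
proof -
  have *: "norm (p ^ m / (1 + p ^ (2 * m))) \<le> inverse (1 - norm p) * norm p ^ m" for m :: nat
  proof -
    have "1 - norm p \<le> norm (1 + p ^ (2 * m))"
    proof (cases "m = 0")
      case False
      have "norm p ^ (2 * m) \<le> norm p ^ 1"
        using p False by (intro power_decreasing) auto
      moreover have "1 - norm (p ^ (2 * m)) \<le> norm (1 + p ^ (2 * m))"
        by (metis diff_minus_eq_add norm_minus_cancel norm_one norm_triangle_ineq2)
      ultimately show ?thesis by (simp add: norm_power)
    qed (simp, use norm_ge_zero[of p] in linarith)
    hence "norm p ^ m / norm (1 + p ^ (2 * m)) \<le> norm p ^ m / (1 - norm p)"
      using p by (intro divide_left_mono mult_pos_pos) auto
    hence "norm (p ^ m / (1 + p ^ (2 * m))) \<le> norm p ^ m / (1 - norm p)"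
      by (simp only: norm_divide norm_power)
    thus ?thesis
      by (simp only: divide_inverse mult.commute)
  qed
  have eq: "p powi int m / (1 + p powi (2 * int m)) = p ^ m / (1 + p ^ (2 * m))" for m
    using power_int_of_nat[of p "2 * m"] by simp
  have **: "norm (p powi int m / (1 + p powi (2 * int m))) \<le> inverse (1 - norm p) * norm p ^ m" for m
    unfolding eq by (rule *)
  show ?thesis
  proof (cases "n \<ge> 0")
    case True
    thus ?thesis using **[of "nat n"] by simp
  next
    case False
    hence "int (nat (- n)) = - n" by simp
    thus ?thesis
      using **[of "nat (- n)"] False unfolding sech_term_even[of n, symmetric] by simp
  qed
qed

lemma sech_abs_summable: "(\<lambda>n::int. norm (p powi n / (1 + p powi (2 * n)))) summable_on UNIV"
proof (rule summable_on_int_dominated)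
  show "norm (p powi n / (1 + p powi (2 * n))) \<le> inverse (1 - norm p) * norm p ^ nat \<bar>n\<bar>" for n
    by (rule sech_term_bound)
qed (use p in auto)

lemma sech_sum_expansion: "sech_sum p = 1 + 4 * (\<Sum>n. p ^ Suc n / (1 + p ^ (2 * Suc n)))"
proof -
  have "p powi int m / (1 + p powi (2 * int m)) = p ^ m / (1 + p ^ (2 * m))" for m
    using power_int_of_nat[of p "2 * m"] by simp
  note eq = this
  have "(\<Sum>\<^sub>\<infinity>n::int. p powi n / (1 + p powi (2 * n)))
      = p powi 0 / (1 + p powi (2 * 0)) + 2 * (\<Sum>n. p powi int (Suc n) / (1 + p powi (2 * int (Suc n))))"
    by (rule infsum_int_split[OF sech_abs_summable sech_term_even])
  thus ?thesis
    unfolding sech_sum_def eq by (simp only: power_int_0_right mult_zero_right) simp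
qed

text \<open>Serves for the limit as p tends to 0, where the value tends to 1.\<close>

lemma norm_sech_sum_minus_1: "norm (sech_sum p - 1) \<le> 4 * norm p / (1 - norm p) ^ 2"
proof -
  have "(\<lambda>n. norm p ^ Suc n) sums (norm p * (1 / (1 - norm p)))"
    using sums_mult[OF geometric_sums[of "norm p"], of "norm p"] p by simp
  from sums_mult[OF this] have g: "(\<lambda>n. inverse (1 - norm p) * norm p ^ Suc n) sums
      (inverse (1 - norm p) * (norm p * (1 / (1 - norm p))))" .
  have "norm (p ^ Suc n / (1 + p ^ (2 * Suc n))) \<le> inverse (1 - norm p) * norm p ^ Suc n" for n
  proof -
    have "p powi (2 * int (Suc n)) = p ^ (2 * Suc n)"
      using power_int_of_nat[of p "2 * Suc n"] by simp
    moreover have "nat \<bar>int (Suc n)\<bar> = Suc n" by simp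
    ultimately show ?thesis
      using sech_term_bound[of "int (Suc n)"] by (simp only: power_int_of_nat)
  qed
  hence "norm (\<Sum>n. p ^ Suc n / (1 + p ^ (2 * Suc n))) \<le> (\<Sum>n. inverse (1 - norm p) * norm p ^ Suc n)"
    using g by (intro norm_suminf_le) (auto simp: sums_iff)
  also have "\<dots> = norm p / (1 - norm p) ^ 2"
    using g by (simp add: sums_iff power2_eq_square divide_inverse mult_ac)
  finally show ?thesis
    unfolding sech_sum_expansion by (simp add: norm_mult)
qed

text \<open>Serves for the limit as p tends to 0, and for nonvanishing at small p.\<close>

lemma norm_theta3_0_minus_1: "norm (theta3_0 p - 1) \<le> 2 * norm p / (1 - norm p)"
proof -
  have g: "(\<lambda>n. norm p ^ Suc n) sums (norm p * (1 / (1 - norm p)))"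
    using sums_mult[OF geometric_sums[of "norm p"], of "norm p"] p by simp
  have "norm (p powi (int (Suc n) ^ 2)) \<le> norm p ^ Suc n" for n
  proof -
    have "norm (p powi (int (Suc n) ^ 2)) = norm p ^ (Suc n ^ 2)"
      by (metis norm_power of_nat_power power_int_of_nat)
    also have "\<dots> \<le> norm p ^ Suc n"
      using p by (intro power_decreasing) (auto simp: power2_eq_square)
    finally show ?thesis .
  qed
  hence "norm (\<Sum>n. p powi (int (Suc n) ^ 2)) \<le> (\<Sum>n. norm p ^ Suc n)"
    using g by (intro norm_suminf_le) (auto simp: sums_iff)
  also have "\<dots> = norm p / (1 - norm p)"
    using g by (simp add: sums_iff)
  finally have "norm (\<Sum>n. p powi (int (Suc n) ^ 2)) \<le> norm p / (1 - norm p)" .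
  moreover have "theta3_0 p = 1 + 2 * (\<Sum>n. p powi (int (Suc n) ^ 2))"
    unfolding theta3_0_def by (subst infsum_int_split[OF theta_abs_summable[OF p]]) auto
  ultimately show ?thesis
    by (simp add: norm_mult del: of_nat_Suc)
qed

text \<open>The terms with odd n cancel, and the term at 2 n is the n-th term for p^2.\<close>

lemma sech_sum_duplication: "sech_sum p + sech_sum (- p) = 2 * sech_sum (p ^ 2)"
proof -
  let ?A = "\<lambda>n::int. p powi n / (1 + p powi (2 * n))"
  have m: "(- p) powi n / (1 + (- p) powi (2 * n)) = sgi n * ?A n" for n
  proof -
    have "(- p) powi (2 * n) = p powi (2 * n)" "(- p) powi n = sgi n * p powi n"
      by (simp_all add: power_int_minus_left)
    thus ?thesis by simp
  qed
  have s: "?A summable_on UNIV" "(\<lambda>n. sgi n * ?A n) summable_on UNIV"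
  proof -
    show "?A summable_on UNIV"
      by (rule abs_summable_summable[OF sech_abs_summable])
    show "(\<lambda>n. sgi n * ?A n) summable_on UNIV"
      by (rule abs_summable_summable) (simp only: norm_mult norm_sgi mult_1_left sech_abs_summable)
  qed
  have "infsum ?A UNIV + (\<Sum>\<^sub>\<infinity>n. sgi n * ?A n) = (\<Sum>\<^sub>\<infinity>n. (1 + sgi n) * ?A n)"
    by (subst infsum_add[symmetric, OF s]) (simp only: distrib_right mult_1_left)
  also have "\<dots> = infsum (\<lambda>n. (1 + sgi n) * ?A n) {n. even n}"
    by (rule infsum_cong_neutral) (auto simp: sgi_odd)
  also have "\<dots> = (\<Sum>\<^sub>\<infinity>n. (1 + sgi (2 * n)) * ?A (2 * n))"
    by (rule infsum_reindex_bij_betw[symmetric]) (auto intro!: bij_betwI[of _ _ _ "\<lambda>n. n div 2"])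
  also have "\<dots> = (\<Sum>\<^sub>\<infinity>n. 2 * ((p ^ 2) powi n / (1 + (p ^ 2) powi (2 * n))))"
  proof (rule infsum_cong)
    fix n :: int
    have e: "p powi (2 * n) = (p ^ 2) powi n" for n :: int
      by (simp add: power_int_mult)
    show "(1 + sgi (2 * n)) * ?A (2 * n) = 2 * ((p ^ 2) powi n / (1 + (p ^ 2) powi (2 * n)))"
      unfolding e by (simp add: sgi_even)
  qed
  also have "\<dots> = 2 * (\<Sum>\<^sub>\<infinity>n. (p ^ 2) powi n / (1 + (p ^ 2) powi (2 * n)))"
    by (rule infsum_cmult_right')
  finally show ?thesis
    unfolding sech_sum_def m distrib_left[symmetric, of 2] by (rule arg_cong)
qed

text \<open>The Fourier coefficients of the product of \<open>\<Sum> z\<^sup>n / (p\<^sup>n + p\<^sup>-\<^sup>n)\<close> with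
  \<open>\<Sum> (-1)\<^sup>j p\<^bsup>j\<^sup>2\<^esup> z\<^sup>j\<close> satisfy a first-order recursion, which makes the product a
  multiple of \<open>\<Sum> p\<^bsup>j\<^sup>2\<^esup> z\<^sup>j\<close>; only \<open>z = 1\<close> is needed.\<close>

lemma sech_sum_theta3_0: "sech_sum p * theta3_0 (- p) = 2 * sech_theta_coeff p * theta3_0 p"
proof -
  define A where "A = (\<lambda>n::int. p powi n / (1 + p powi (2 * n)))"
  define b where "b = (\<lambda>m::int. \<Sum>\<^sub>\<infinity>n. sgi n * A n * p powi (n ^ 2 - 2 * m * n))"
  obtain C where C: "\<And>n. norm (A n) \<le> C" "C > 0"
  proof
    show "norm (A n) \<le> inverse (1 - norm p)" for n
    proof -
      have "inverse (1 - norm p) * norm p ^ nat \<bar>n\<bar> \<le> inverse (1 - norm p) * 1"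
        using p by (intro mult_left_mono power_le_one) auto
      with sech_term_bound[of n] show ?thesis by (simp add: A_def)
    qed
  qed (use p in auto)
  have sb: "(\<lambda>n. sgi n * A n * p powi (n ^ 2 - k * n)) summable_on UNIV" for k
  proof -
    \<comment> \<open>Division by the bound \<open>C\<close> brings the coefficients to modulus at
      most 1, as the general summability lemma requires.\<close>
    have "(\<lambda>n. norm ((sgi n * A n / of_real C) * p powi (n ^ 2 - k * n))) summable_on UNIV"
      using C by (intro powi_quadratic_abs_summable p) (auto simp: norm_mult norm_divide norm_sgi)
    hence "(\<lambda>n. of_real C * ((sgi n * A n / of_real C) * p powi (n ^ 2 - k * n))) summable_on UNIV"
      by (intro summable_on_cmult_right) (rule abs_summable_summable)
    thus ?thesis using C by simp
  qed
  \<comment> \<open>Adding two consecutive coefficients cancels the denominator 1 + p^(2 n) and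
    leaves a signed theta series with an odd linear term in the exponent.\<close>
  have step: "b (m + 1) = - b m" for m
  proof -
    have "b m + b (m + 1) = (\<Sum>\<^sub>\<infinity>n. sgi n * p powi (n ^ 2 - (2 * m + 1) * n))"
      unfolding b_def
    proof (subst infsum_add[symmetric, OF sb sb], rule infsum_cong)
      fix n :: int
      have "p powi (n ^ 2 - 2 * m * n) + p powi (n ^ 2 - 2 * (m + 1) * n)
          = p powi (n ^ 2 - 2 * m * n) * (1 + p powi (- (2 * n)))"
        using p by (simp add: algebra_simps flip: power_int_add)
      moreover have "A n * (1 + p powi (- (2 * n))) = p powi (- n)"
        using sech_term_even[of n] one_plus_powi_neq_0'[of "- (2 * n)"] by (simp add: A_def field_simps)
      ultimately have "A n * p powi (n ^ 2 - 2 * m * n) + A n * p powi (n ^ 2 - 2 * (m + 1) * n)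
          = p powi (n ^ 2 - 2 * m * n) * p powi (- n)"
        by (metis distrib_left mult.left_commute)
      also have "\<dots> = p powi (n ^ 2 - (2 * m + 1) * n)"
        using p by (simp add: algebra_simps flip: power_int_add)
      finally show "sgi n * A n * p powi (n ^ 2 - 2 * m * n) + sgi n * A n * p powi (n ^ 2 - 2 * (m + 1) * n)
          = sgi n * p powi (n ^ 2 - (2 * m + 1) * n)"
        by (simp only: mult.assoc distrib_left[symmetric])
    qed
    also have "\<dots> = 0"
    proof -
      let ?f = "\<lambda>n::int. sgi n * p powi (n ^ 2 - (2 * m + 1) * n)"
      \<comment> \<open>The reflection of n to 2 m + 1 - n preserves the exponent and reverses the
        sign, so the series equals its own negative.\<close>
      have "infsum ?f UNIV = infsum (\<lambda>n. ?f (2 * m + 1 - n)) UNIV"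
        by (rule infsum_reindex_bij_betw[symmetric]) (auto intro!: bij_betwI[of _ _ _ "\<lambda>n. 2 * m + 1 - n"])
      also have "\<dots> = infsum (\<lambda>n. - ?f n) UNIV"
      proof (rule infsum_cong)
        fix n :: int
        have "(2 * m + 1 - n) ^ 2 - (2 * m + 1) * (2 * m + 1 - n) = n ^ 2 - (2 * m + 1) * n"
          by (simp add: power2_eq_square algebra_simps)
        thus "?f (2 * m + 1 - n) = - ?f n"
          by (simp add: sgi_diff sgi_odd)
      qed
      also have "\<dots> = - infsum ?f UNIV"
        by (rule infsum_uminus)
      finally show ?thesis by simp
    qed
    finally show ?thesis by (simp add: eq_neg_iff_add_eq_0 add.commute)
  qed
  have b: "b m = sgi m * b 0" for m
  proof (induction m rule: int_induct[of _ 0])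
    case (step1 i)
    thus ?case by (simp add: step sgi_add)
  next
    case (step2 i)
    have "b (i - 1) = - b i" using step[of "i - 1"] by simp
    with step2 show ?case by (simp add: sgi_diff)
  qed simp
  have b0: "b 0 = sech_theta_coeff p"
    by (simp add: b_def sech_theta_coeff_def A_def)
  have As: "(\<lambda>n. norm (A n)) summable_on UNIV"
    unfolding A_def by (rule sech_abs_summable)
  note P = infsum_mult_infsum[OF As signed_theta_abs_summable[OF p]]
  let ?F = "\<lambda>(n, j). A n * (sgi j * p powi (j ^ 2))"
  \<comment> \<open>Regroups the double sum by the Fourier degree m = n + j.\<close>
  let ?r = "\<lambda>(m::int, n::int). (n, m - n)"
  define G where "G = (\<lambda>m n. A n * (sgi (m - n) * p powi ((m - n) ^ 2)))"
  have bij: "bij_betw ?r (UNIV \<times> UNIV) (UNIV \<times> UNIV)"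
    by (rule bij_betwI[of _ _ _ "\<lambda>(n, j). (n + j, n)"]) auto
  have "infsum A UNIV * theta3_0 (- p) = infsum ?F (UNIV \<times> UNIV)"
    unfolding signed_theta_eq P(2) ..
  also have "\<dots> = infsum (\<lambda>z. ?F (?r z)) (UNIV \<times> UNIV)"
    by (rule infsum_reindex_bij_betw[symmetric, OF bij])
  also have "(\<lambda>z. ?F (?r z)) = (\<lambda>(m, n). G m n)"
    by (auto simp: G_def)
  also have "infsum \<dots> (UNIV \<times> UNIV) = (\<Sum>\<^sub>\<infinity>m. \<Sum>\<^sub>\<infinity>n. G m n)"
  proof (rule infsum_Sigma'_banach[symmetric])
    have "(\<lambda>z. ?F (?r z)) summable_on UNIV \<times> UNIV"
      using P(1) unfolding summable_on_reindex_bij_betw[OF bij, of ?F] .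
    thus "(\<lambda>(m, n). G m n) summable_on UNIV \<times> UNIV"
      unfolding G_def by (simp add: case_prod_unfold)
  qed
  also have "\<dots> = (\<Sum>\<^sub>\<infinity>m. sech_theta_coeff p * p powi (m ^ 2))"
  proof (rule infsum_cong)
    fix m :: int
    have "(\<Sum>\<^sub>\<infinity>n. G m n) = (\<Sum>\<^sub>\<infinity>n. (sgi m * p powi (m ^ 2)) * (sgi n * A n * p powi (n ^ 2 - 2 * m * n)))"
    proof (rule infsum_cong)
      fix n :: int
      have "p powi ((m - n) ^ 2) = p powi (m ^ 2) * p powi (n ^ 2 - 2 * m * n)"
        using p by (simp add: power2_eq_square algebra_simps flip: power_int_add)
      thus "G m n = (sgi m * p powi (m ^ 2)) * (sgi n * A n * p powi (n ^ 2 - 2 * m * n))"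
        by (simp add: G_def sgi_diff)
    qed
    also have "\<dots> = (sgi m * p powi (m ^ 2)) * b m"
      unfolding b_def by (rule infsum_cmult_right')
    also have "\<dots> = (sgi m * sgi m) * (b 0 * p powi (m ^ 2))"
      by (subst b) simp
    also have "sgi m * sgi m = 1"
      by (simp flip: sgi_add add: sgi_even)
    finally show "(\<Sum>\<^sub>\<infinity>n. G m n) = sech_theta_coeff p * p powi (m ^ 2)"
      by (simp add: b0)
  qed
  also have "\<dots> = sech_theta_coeff p * theta3_0 p"
    unfolding theta3_0_def by (rule infsum_cmult_right')
  finally show ?thesis
    by (simp add: sech_sum_def A_def)
qed

end

section \<open>Nonvanishing of theta and the two square theorem\<close>

lemma sech_theta_coeff_minus:
  assumes p: "p \<noteq> 0" "norm p < 1"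
  shows "sech_theta_coeff (- p) = sech_theta_coeff p"
  unfolding sech_theta_coeff_def
proof (rule infsum_cong)
  fix n :: int
  \<comment> \<open>Here a will be (-1)^n: replacing p by -p produces it once from p^n and once from
    p^(n^2), and the two cancel.\<close>
  have a: "a * (a * x / y) * (a * t) = a * (x / y) * t" if "a * a = 1" for a x y t :: complex
  proof -
    have "a * (a * x / y) * (a * t) = (a * a) * (a * (x / y) * t)" by simp
    thus ?thesis unfolding that by simp
  qed
  have b: "(- p) powi (2 * n) = p powi (2 * n)" "(- p) powi n = sgi n * p powi n"
    by (simp_all add: power_int_minus_left)
  show "sgi n * ((- p) powi n / (1 + (- p) powi (2 * n))) * (- p) powi (n ^ 2)
      = sgi n * (p powi n / (1 + p powi (2 * n))) * p powi (n ^ 2)"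
    unfolding powi_neg_square b by (rule a) (simp flip: sgi_add add: sgi_even)
qed

text \<open>By \<open>theta3_0_times_minus\<close> a zero at p propagates to the points
  -p^(2^(k+1)). These tend to 0, where the value is close to 1.\<close>

lemma theta3_0_neq_0:
  assumes p: "p \<noteq> 0" "norm p < 1"
  shows "theta3_0 p \<noteq> 0"
proof
  assume 0: "theta3_0 p = 0"
  have z: "theta3_0 (- (p ^ (2 ^ Suc k))) = 0" for k
  proof (induction k)
    case 0
    thus ?case using theta3_0_times_minus[OF p] \<open>theta3_0 p = 0\<close> by simp
  next
    case (Suc k)
    define y where "y = p ^ (2 ^ Suc k)"
    have y: "y \<noteq> 0" "norm y < 1"
      using p by (auto simp: y_def norm_power power_less_one_iff simp del: power_Suc)
    have eq: "y ^ 2 = p ^ (2 ^ Suc (Suc k))"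
      unfolding y_def power_mult[symmetric] by (simp add: mult.commute)
    have "theta3_0 (- y) = 0"
      using Suc unfolding y_def .
    hence "theta3_0 (- (y ^ 2)) = 0"
      using theta3_0_times_minus[OF y] by simp
    thus ?case unfolding eq .
  qed
  \<comment> \<open>Any bound up to 1 / 3 would do: 2 x / (1 - x) reaches 1 at x = 1 / 3.\<close>
  obtain N where N: "norm p ^ N < 1 / 4"
    using real_arch_pow_inv[of "1 / 4" "norm p"] p by auto
  define y where "y = - (p ^ (2 ^ Suc N))"
  have "N \<le> 2 ^ Suc N"
    using less_exp[of "Suc N"] by linarith
  hence "norm p ^ (2 ^ Suc N) \<le> norm p ^ N"
    using p by (intro power_decreasing) auto
  moreover have "norm y = norm p ^ (2 ^ Suc N)"
    by (simp add: y_def norm_power del: power_Suc)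
  ultimately have y: "norm y < 1 / 4" "y \<noteq> 0"
    using p N by (linarith, simp add: y_def)
  have "norm (theta3_0 y - 1) \<le> 2 * norm y / (1 - norm y)"
    using y by (intro norm_theta3_0_minus_1) auto
  moreover have "theta3_0 y = 0"
    unfolding y_def by (rule z)
  moreover have "2 * norm y / (1 - norm y) < 1"
    using y by (subst divide_less_eq_1) auto
  ultimately show False by simp
qed

text \<open>The product formulas at x and -x share \<open>sech_theta_coeff\<close>; eliminating it
  shows that the quotient \<open>R\<close> agrees at x and -x. With the two duplication formulas it
  then also agrees at x and x^2, and iteration moves the argument to 0.\<close>

theorem sech_sum_eq_theta3_0_square:
  assumes p: "p \<noteq> 0" "norm p < 1"
  shows "sech_sum p = theta3_0 p ^ 2"
proof -
  define R where "R = (\<lambda>x. sech_sum x / theta3_0 x ^ 2)"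
  have step: "R (x ^ 2) = R x" if x: "x \<noteq> 0" "norm x < 1" for x
  proof -
    have x2: "x ^ 2 \<noteq> 0" "norm (x ^ 2) < 1"
      using x by (auto simp: norm_power power_less_one_iff)
    have "sech_sum (- x) * theta3_0 x = 2 * sech_theta_coeff x * theta3_0 (- x)"
      using sech_sum_theta3_0[of "- x"] x sech_theta_coeff_minus[OF x] by simp
    hence cross: "sech_sum x * theta3_0 (- x) ^ 2 = sech_sum (- x) * theta3_0 x ^ 2"
      using sech_sum_theta3_0[OF x] by (simp add: power2_eq_square flip: mult.assoc)
    have "2 * (sech_sum x * theta3_0 (x ^ 2) ^ 2) = sech_sum x * (theta3_0 x ^ 2 + theta3_0 (- x) ^ 2)"
      unfolding theta3_0_square_sum[OF x] by simp
    also have "\<dots> = theta3_0 x ^ 2 * (sech_sum x + sech_sum (- x))"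
      unfolding distrib_left cross by simp
    also have "\<dots> = 2 * (sech_sum (x ^ 2) * theta3_0 x ^ 2)"
      unfolding sech_sum_duplication[OF x] by simp
    finally show ?thesis
      using theta3_0_neq_0[OF x] theta3_0_neq_0[OF x2] by (simp add: R_def field_simps)
  qed
  define y where "y = (\<lambda>k. p ^ (2 ^ k))"
  have y: "y k \<noteq> 0" "norm (y k) < 1" for k
    using p by (auto simp: y_def norm_power power_less_one_iff)
  have R: "R (y k) = R p" for k
  proof (induction k)
    case (Suc k)
    have "y (Suc k) = y k ^ 2"
      unfolding y_def power_mult[symmetric] by (simp add: mult.commute)
    thus ?case using step[OF y[of k]] Suc by simp
  qed (simp add: y_def)
  have "strict_mono (\<lambda>k. 2 ^ k :: nat)"
    by (simp add: strict_mono_def)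
  from LIMSEQ_subseq_LIMSEQ[OF LIMSEQ_power_zero[OF p(2)] this]
  have "y \<longlonglongrightarrow> 0"
    by (simp add: y_def[abs_def] o_def)
  hence ny: "(\<lambda>k. norm (y k)) \<longlonglongrightarrow> 0"
    by (rule tendsto_norm_zero)
  have "(\<lambda>k. sech_sum (y k) - 1) \<longlonglongrightarrow> 0"
  proof (rule Lim_null_comparison)
    show "\<forall>\<^sub>F k in sequentially. norm (sech_sum (y k) - 1) \<le> 4 * norm (y k) / (1 - norm (y k)) ^ 2"
      using norm_sech_sum_minus_1[OF y] by simp
    have "(\<lambda>k. 4 * norm (y k) / (1 - norm (y k)) ^ 2) \<longlonglongrightarrow> 4 * 0 / (1 - 0) ^ 2"
      by (intro tendsto_intros ny) auto
    thus "(\<lambda>k. 4 * norm (y k) / (1 - norm (y k)) ^ 2) \<longlonglongrightarrow> 0" by simp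
  qed
  hence s: "(\<lambda>k. sech_sum (y k)) \<longlonglongrightarrow> 1"
    by (rule LIM_zero_cancel)
  have "(\<lambda>k. theta3_0 (y k) - 1) \<longlonglongrightarrow> 0"
  proof (rule Lim_null_comparison)
    show "\<forall>\<^sub>F k in sequentially. norm (theta3_0 (y k) - 1) \<le> 2 * norm (y k) / (1 - norm (y k))"
      using norm_theta3_0_minus_1[OF y] by simp
    have "(\<lambda>k. 2 * norm (y k) / (1 - norm (y k))) \<longlonglongrightarrow> 2 * 0 / (1 - 0)"
      by (intro tendsto_intros ny) auto
    thus "(\<lambda>k. 2 * norm (y k) / (1 - norm (y k))) \<longlonglongrightarrow> 0" by simp
  qed
  hence t: "(\<lambda>k. theta3_0 (y k)) \<longlonglongrightarrow> 1"
    by (rule LIM_zero_cancel)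
  have "(\<lambda>k. R (y k)) \<longlonglongrightarrow> 1 / 1 ^ 2"
    unfolding R_def by (intro tendsto_intros s t) auto
  hence "R p = 1"
    by (simp add: R LIMSEQ_const_iff)
  thus ?thesis
    using theta3_0_neq_0[OF p] by (simp add: R_def)
qed

section \<open>An elliptic function on an annulus\<close>

text \<open>For 0 < |q| < 1 this annulus contains -1 but no other point -q^m, and it overlaps its
  image under multiplication by q.\<close>

definition annulus :: "complex \<Rightarrow> complex set" where
  "annulus q = {z. norm q < norm z \<and> norm z < 1 / norm q}"

lemma open_annulus: "open (annulus q)"
  unfolding annulus_def by (intro open_Collect_conj open_Collect_less continuous_intros)

lemma connected_annulus_set: "connected (annulus q)"
  using connected_annulus(1)[of "norm q" "0 :: complex" "1 / norm q"] by (simp add: annulus_def)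

lemma annulusD:
  assumes "z \<in> annulus q"
  shows "z \<noteq> 0" "norm (q * z) < 1" "norm (q * (1 / z)) < 1"
proof -
  show z: "z \<noteq> 0"
    using assms by (auto simp: annulus_def)
  have "q \<noteq> 0 \<Longrightarrow> norm q * norm z < norm q * (1 / norm q)"
    using assms by (intro mult_strict_left_mono) (auto simp: annulus_def)
  thus "norm (q * z) < 1"
    by (cases "q = 0") (auto simp: norm_mult)
  show "norm (q * (1 / z)) < 1"
    using assms z by (simp add: annulus_def norm_divide divide_simps)
qed

lemma annulusI:
  assumes "1 \<le> norm z" "norm z < 1 / norm q" "norm q < 1"
  shows "z \<in> annulus q"
  using assms by (auto simp: annulus_def)

lemma minus_in_annulus: "- z \<in> annulus q \<longleftrightarrow> z \<in> annulus q"
  by (simp add: annulus_def)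

text \<open>Up to the action of \<open>q\<close>, every point of the annulus lies in the compact annulus between the
  circles of radius \<open>\<surd>|q|\<close> and \<open>1 / \<surd>|q|\<close>, so the modulus attains its maximum.\<close>

lemma constant_on_annulus:
  fixes q :: complex
  assumes q: "q \<noteq> 0" "norm q < 1" and hol: "H holomorphic_on annulus q"
    and quasi: "\<And>z. 1 < norm z \<Longrightarrow> norm z < 1 / norm q \<Longrightarrow> norm (H (q * z)) = norm (H z)"
  obtains c where "\<And>z. z \<in> annulus q \<Longrightarrow> H z = c"
proof -
  define s where "s = sqrt (norm q)"
  have s: "0 < s" "s < 1" "norm q = s * s"
    using q by (auto simp: s_def)
  have "s * s < s * 1"
    using s by (intro mult_strict_left_mono) auto
  hence ss: "s * s < s" "s * s < 1"
    using s by linarith+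
  have s1: "s * s < s" "1 / s < 1 / (s * s)" "s < 1 / s" "1 < 1 / s"
    using s ss by (simp_all add: divide_simps mult.commute)
  define K where "K = cball 0 (1 / s) - ball (0 :: complex) s"
  have K: "z \<in> K \<longleftrightarrow> s \<le> norm z \<and> norm z \<le> 1 / s" for z
    by (auto simp: K_def)
  have KA: "K \<subseteq> annulus q"
  proof
    fix z assume "z \<in> K"
    thus "z \<in> annulus q"
      using s1 unfolding K annulus_def mem_Collect_eq s(3) by linarith
  qed
  have "compact K"
    unfolding K_def by (intro compact_diff) auto
  moreover have "complex_of_real s \<in> K"
  proof -
    have n: "norm (complex_of_real s) = s" using s by simp
    show ?thesis unfolding K n using less_imp_le[OF s1(3)] by blast
  qed
  moreover have "continuous_on K (\<lambda>z. norm (H z))"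
    by (intro continuous_intros holomorphic_on_imp_continuous_on holomorphic_on_subset[OF hol KA])
  ultimately obtain \<xi> where \<xi>: "\<xi> \<in> K" "\<And>z. z \<in> K \<Longrightarrow> norm (H z) \<le> norm (H \<xi>)"
    using continuous_attains_sup[of K "\<lambda>z. norm (H z)"] by auto
  have max: "norm (H z) \<le> norm (H \<xi>)" if z: "z \<in> annulus q" for z
  proof -
    have zb: "s * s < norm z" "norm z < 1 / (s * s)"
      using z by (auto simp: annulus_def s)
    \<comment> \<open>A point outside \<open>K\<close> enters it after one multiplication or
      division by q, and \<open>quasi\<close> preserves the modulus of \<open>H\<close> on the
      way.\<close>
    consider "z \<in> K" | "norm z > 1 / s" | "norm z < s"
      by (force simp: K)
    thus ?thesis
    proof cases
      case 1
      thus ?thesis by (rule \<xi>(2))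
    next
      case 2
      have "norm (q * z) = s * s * norm z"
        by (simp add: norm_mult s)
      moreover have "s \<le> s * s * norm z" "s * s * norm z \<le> 1 / s"
      proof -
        have "s * s * (1 / s) \<le> s * s * norm z"
          using 2 s by (intro mult_left_mono) auto
        thus "s \<le> s * s * norm z" using s by simp
        have "s * s * norm z \<le> s * s * (1 / (s * s))"
          using zb s by (intro mult_left_mono) auto
        moreover have "s * s * (1 / (s * s)) = 1" using s by simp
        ultimately show "s * s * norm z \<le> 1 / s" using s1(4) by linarith
      qed
      ultimately have "q * z \<in> K" by (simp add: K)
      hence "norm (H (q * z)) \<le> norm (H \<xi>)" by (rule \<xi>(2))
      moreover have "norm (H (q * z)) = norm (H z)"
        using 2 s1(4) zb by (intro quasi) (unfold s(3), linarith+)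
      ultimately show ?thesis by simp
    next
      case 3
      have n: "norm (z / q) = norm z / (s * s)"
        by (simp add: norm_divide s)
      have "norm z / (s * s) < s / (s * s)"
        using 3 s by (intro divide_strict_right_mono) auto
      hence b: "1 < norm z / (s * s)" "norm z / (s * s) < 1 / s"
        using zb s by auto
      have "z / q \<in> K" unfolding K n using b s(2) by linarith
      hence "norm (H (z / q)) \<le> norm (H \<xi>)" by (rule \<xi>(2))
      moreover have "norm (H (q * (z / q))) = norm (H (z / q))"
        using b s1(2) by (intro quasi) (unfold n s(3), linarith+)
      ultimately show ?thesis using q by simp
    qed
  qed
  have "H constant_on annulus q"
    by (rule maximum_modulus_principle[OF hol open_annulus connected_annulus_set open_annulus subset_refl _ max])
       (use \<xi> KA in auto)
  thus ?thesis
    unfolding constant_on_def using that by blast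
qed

section \<open>Lambert series and their derivatives with respect to t = log z\<close>

definition lambert_coeff :: "complex \<Rightarrow> nat \<Rightarrow> complex" where
  "lambert_coeff q r = - ((- q) ^ r / (1 + q ^ r))"

text \<open>The exponent \<open>m\<close> counts applications of z d/dz. The term r = 0, equal to
  -1/2, survives only for m = 0 and cancels in \<open>odd_lambert\<close>.\<close>

definition lambert :: "complex \<Rightarrow> nat \<Rightarrow> complex \<Rightarrow> complex" where
  "lambert q m z = (\<Sum>r. of_nat r ^ m * lambert_coeff q r * z ^ r)"

text \<open>The m-th t-derivative of F(t) - F(-t), where F is the Lambert series at z = e^t; hence
  the sign.\<close>

definition odd_lambert :: "complex \<Rightarrow> nat \<Rightarrow> complex \<Rightarrow> complex" where
  "odd_lambert q m z = lambert q m z - (-1) ^ m * lambert q m (1 / z)"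

definition pole_part :: "complex \<Rightarrow> complex" where
  "pole_part z = 1 / (1 + z) - 1 / 2"

text \<open>With \<open>z = e\<^sup>t\<close> and up to scaling, \<open>elliptic q\<close> is a quotient of Jacobi theta functions;
  \<open>elliptic1\<close> and \<open>elliptic2\<close> are its derivatives with respect to \<open>t\<close>.\<close>

definition elliptic :: "complex \<Rightarrow> complex \<Rightarrow> complex" where
  "elliptic q z = odd_lambert q 0 z + pole_part z"

definition elliptic1 :: "complex \<Rightarrow> complex \<Rightarrow> complex" where
  "elliptic1 q z = odd_lambert q 1 z + (pole_part z ^ 2 - 1 / 4)"

definition elliptic2 :: "complex \<Rightarrow> complex \<Rightarrow> complex" where
  "elliptic2 q z = odd_lambert q 2 z + (2 * pole_part z ^ 3 - pole_part z / 2)"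

context
  fixes q :: complex
  assumes q: "q \<noteq> 0" "norm q < 1"
begin

lemma one_plus_q_power_bound: "1 - norm q \<le> norm (1 + q ^ r)"
proof (cases r)
  case 0
  thus ?thesis using norm_ge_zero[of q] by (simp, linarith)
next
  case (Suc k)
  have "norm q ^ r \<le> norm q ^ 1"
    using q Suc by (intro power_decreasing) auto
  moreover have "1 - norm (q ^ r) \<le> norm (1 + q ^ r)"
    by (metis diff_minus_eq_add norm_minus_cancel norm_one norm_triangle_ineq2)
  ultimately show ?thesis by (simp add: norm_power)
qed

lemma one_plus_q_power_neq_0: "1 + q ^ r \<noteq> 0"
  using one_plus_q_power_bound[of r] q by auto

lemma norm_lambert_coeff: "norm (lambert_coeff q r) \<le> norm q ^ r / (1 - norm q)"
proof -
  have "norm q ^ r / norm (1 + q ^ r) \<le> norm q ^ r / (1 - norm q)"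
    using q one_plus_q_power_bound[of r] one_plus_q_power_neq_0[of r] by (intro divide_left_mono mult_pos_pos) auto
  thus ?thesis by (simp add: lambert_coeff_def norm_divide norm_power)
qed

text \<open>A further factor r arises from termwise differentiation followed by multiplication with
  z, neither of which shrinks the disc of convergence.\<close>

lemma lambert_summable:
  assumes z: "norm z < 1 / norm q"
  shows "summable (\<lambda>r. of_nat r ^ m * lambert_coeff q r * z ^ r)"
  using z
proof (induction m arbitrary: z)
  case 0
  have "norm (q * z) < 1"
    using 0 q by (simp add: norm_mult field_simps)
  hence "summable (\<lambda>r. norm (q * z) ^ r / (1 - norm q))"
    by (intro summable_divide summable_geometric) auto
  thus ?case
  proof (rule summable_comparison_test'[where N = 0])
    fix r :: nat
    have "norm (lambert_coeff q r * z ^ r) \<le> norm q ^ r / (1 - norm q) * norm z ^ r"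
      unfolding norm_mult norm_power by (intro mult_right_mono norm_lambert_coeff) auto
    thus "norm (of_nat r ^ 0 * lambert_coeff q r * z ^ r) \<le> norm (q * z) ^ r / (1 - norm q)"
      by (simp add: norm_mult power_mult_distrib)
  qed
next
  case (Suc m)
  have "summable (\<lambda>r. diffs (\<lambda>r. of_nat r ^ m * lambert_coeff q r) r * z ^ r)"
    using Suc.prems Suc.IH by (rule termdiff_converges)
  hence "summable (\<lambda>r. z * (diffs (\<lambda>r. of_nat r ^ m * lambert_coeff q r) r * z ^ r))"
    by (rule summable_mult)
  hence "summable (\<lambda>r. of_nat (Suc r) ^ Suc m * lambert_coeff q (Suc r) * z ^ Suc r)"
    by (simp add: diffs_def mult_ac)
  thus ?case
    by (subst (asm) summable_Suc_iff)
qed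

lemma lambert_has_derivative:
  assumes z: "z \<noteq> 0" "norm z < 1 / norm q"
  shows "(lambert q m has_field_derivative lambert q (Suc m) z / z) (at z)"
proof -
  let ?c = "\<lambda>r. of_nat r ^ m * lambert_coeff q r"
  have "summable (\<lambda>r. diffs ?c r * z ^ r)"
    using z(2) lambert_summable by (rule termdiff_converges)
  from suminf_mult[OF this, of z]
  have "z * (\<Sum>r. diffs ?c r * z ^ r) = (\<Sum>r. of_nat (Suc r) ^ Suc m * lambert_coeff q (Suc r) * z ^ Suc r)"
    by (simp add: diffs_def mult_ac)
  also have "\<dots> = lambert q (Suc m) z"
    unfolding lambert_def using suminf_split_head[OF lambert_summable[OF z(2), of "Suc m"]] by simp
  finally have "(\<Sum>r. diffs ?c r * z ^ r) = lambert q (Suc m) z / z"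
    using z by (simp add: field_simps)
  moreover have "((\<lambda>z. \<Sum>r. ?c r * z ^ r) has_field_derivative (\<Sum>r. diffs ?c r * z ^ r)) (at z)"
    using lambert_summable z(2) by (rule termdiffs_strong')
  ultimately show ?thesis
    by (simp add: lambert_def[abs_def])
qed

lemma norm_less_inverse_norm_q_iff: "norm z < 1 / norm q \<longleftrightarrow> norm (q * z) < 1"
  using q by (simp add: norm_mult field_simps)

lemma odd_lambert_has_derivative:
  assumes z: "z \<in> annulus q"
  shows "(odd_lambert q m has_field_derivative odd_lambert q (Suc m) z / z) (at z)"
proof -
  note zD = annulusD[OF z]
  have inv: "((\<lambda>z. 1 / z) has_field_derivative - (1 / z ^ 2)) (at z)"
    using zD by (auto intro!: derivative_eq_intros simp: power2_eq_square)
  have "((\<lambda>z. lambert q m (1 / z)) has_field_derivative (lambert q (Suc m) (1 / z) / (1 / z)) * - (1 / z ^ 2)) (at z)"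
    using zD by (intro DERIV_chain2[OF lambert_has_derivative inv]) (auto simp: norm_less_inverse_norm_q_iff)
  hence "((\<lambda>z. lambert q m z - (-1) ^ m * lambert q m (1 / z)) has_field_derivative
           (lambert q (Suc m) z / z - (-1) ^ m * ((lambert q (Suc m) (1 / z) / (1 / z)) * - (1 / z ^ 2)))) (at z)"
    using zD by (intro DERIV_diff DERIV_cmult lambert_has_derivative) (auto simp: norm_less_inverse_norm_q_iff)
  thus ?thesis
    using zD by (simp add: odd_lambert_def[abs_def] field_simps power2_eq_square)
qed

text \<open>The Riccati equation w' = w^2 - 1/4 in t. It gives w'' = 2 w^3 - w / 2, the form used in
  \<open>elliptic2\<close>.\<close>

lemma pole_part_has_derivative:
  assumes "z \<noteq> 0" "z \<noteq> -1"
  shows "(pole_part has_field_derivative (pole_part z ^ 2 - 1 / 4) / z) (at z)"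
proof -
  have "1 + z \<noteq> 0"
    using assms by (metis add_eq_0_iff)
  hence "((\<lambda>z. 1 / (1 + z) - 1 / 2) has_field_derivative - (1 / (1 + z) ^ 2)) (at z)"
    by (auto intro!: derivative_eq_intros simp: power2_eq_square)
  moreover have "- (1 / (1 + z) ^ 2) = (pole_part z ^ 2 - 1 / 4) / z"
  proof -
    define u where "u = 1 + z"
    have u: "u \<noteq> 0" "z = u - 1"
      using \<open>1 + z \<noteq> 0\<close> by (auto simp: u_def)
    have "- (1 / u ^ 2) * (u - 1) = (1 / u - 1 / 2) ^ 2 - 1 / 4"
      using u(1) by (simp add: field_simps power2_eq_square)
    hence "- (1 / (1 + z) ^ 2) * z = pole_part z ^ 2 - 1 / 4"
      by (simp add: u_def pole_part_def)
    thus ?thesis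
      using assms(1) by (simp add: eq_divide_eq)
  qed
  ultimately show ?thesis
    by (simp add: pole_part_def[abs_def])
qed

lemma elliptic_has_derivative:
  assumes "z \<in> annulus q" "z \<noteq> -1"
  shows "(elliptic q has_field_derivative elliptic1 q z / z) (at z)"
  unfolding elliptic_def[abs_def] elliptic1_def add_divide_distrib One_nat_def
  using assms annulusD(1)[OF assms(1)]
  by (intro DERIV_add odd_lambert_has_derivative pole_part_has_derivative)

lemma elliptic1_has_derivative:
  assumes z: "z \<in> annulus q" "z \<noteq> -1"
  shows "(elliptic1 q has_field_derivative elliptic2 q z / z) (at z)"
proof -
  have z0: "z \<noteq> 0" by (rule annulusD[OF z(1)])
  note P = pole_part_has_derivative[OF z0 z(2)]
  have "((\<lambda>z. odd_lambert q 1 z + (pole_part z ^ 2 - 1 / 4)) has_field_derivative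
      (odd_lambert q (Suc 1) z / z + of_nat 2 * pole_part z ^ (2 - 1) * ((pole_part z ^ 2 - 1 / 4) / z))) (at z)"
    by (rule derivative_eq_intros refl odd_lambert_has_derivative z P)+ simp
  moreover have "odd_lambert q (Suc 1) z / z + of_nat 2 * pole_part z ^ (2 - 1) * ((pole_part z ^ 2 - 1 / 4) / z)
      = elliptic2 q z / z"
    using z0 by (simp add: elliptic2_def eval_nat_numeral field_simps)
  ultimately show ?thesis
    by (simp add: elliptic1_def[abs_def])
qed

text \<open>Adding the series at z and q z cancels the denominators 1 + q^r and leaves a geometric
  series in -q z.\<close>

lemma lambert_functional_equation:
  assumes "norm (q * z) < 1"
  shows "lambert q 0 z + lambert q 0 (q * z) = - (1 / (1 + q * z))"
proof -
  have "norm (q * (q * z)) \<le> 1 * norm (q * z)"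
    using q by (subst norm_mult, intro mult_right_mono) auto
  hence qz: "norm (q * z) < 1 / norm q"
    using assms by (subst norm_less_inverse_norm_q_iff) auto
  have z: "norm z < 1 / norm q"
    using assms by (subst norm_less_inverse_norm_q_iff)
  have "lambert q 0 z + lambert q 0 (q * z)
      = (\<Sum>r. of_nat r ^ 0 * lambert_coeff q r * z ^ r + of_nat r ^ 0 * lambert_coeff q r * (q * z) ^ r)"
    unfolding lambert_def by (rule suminf_add[OF lambert_summable[OF z] lambert_summable[OF qz]])
  also have "(\<lambda>r. of_nat r ^ 0 * lambert_coeff q r * z ^ r + of_nat r ^ 0 * lambert_coeff q r * (q * z) ^ r)
      = (\<lambda>r. - ((- (q * z)) ^ r))"
  proof
    fix r
    have "of_nat r ^ 0 * lambert_coeff q r * z ^ r + of_nat r ^ 0 * lambert_coeff q r * (q * z) ^ r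
        = lambert_coeff q r * (1 + q ^ r) * z ^ r"
      by (simp add: power_mult_distrib algebra_simps)
    also have "lambert_coeff q r * (1 + q ^ r) = - ((- q) ^ r)"
      using one_plus_q_power_neq_0[of r] by (simp add: lambert_coeff_def)
    also have "- ((- q) ^ r) * z ^ r = - ((- (q * z)) ^ r)"
      by (simp only: mult_minus_left[symmetric, of q z] power_mult_distrib mult_minus_left[of "_ ^ r"])
    finally show "of_nat r ^ 0 * lambert_coeff q r * z ^ r + of_nat r ^ 0 * lambert_coeff q r * (q * z) ^ r
        = - ((- (q * z)) ^ r)" .
  qed
  also have "(\<Sum>r. - ((- (q * z)) ^ r)) = - (\<Sum>r. (- (q * z)) ^ r)"
    by (rule suminf_minus) (use assms in \<open>auto intro!: summable_geometric\<close>)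
  also have "(\<Sum>r. (- (q * z)) ^ r) = 1 / (1 + q * z)"
    using assms by (subst suminf_geometric) auto
  finally show ?thesis .
qed

text \<open>The functional equation is applied at z and at 1 / (q z); the two rational functions it
  produces cancel the pole parts at q z and z.\<close>

lemma elliptic_antiperiodic:
  assumes "1 < norm z" "norm z < 1 / norm q"
  shows "elliptic q (q * z) = - elliptic q z"
proof -
  have z0: "z \<noteq> 0" using assms by auto
  have n1: "1 + z \<noteq> 0"
    using assms by (metis add_eq_0_iff less_irrefl norm_minus_cancel norm_one)
  have qz: "norm (q * z) < 1"
    using assms(2) by (simp add: norm_less_inverse_norm_q_iff)
  hence n2: "1 + q * z \<noteq> 0"
    by (metis add_eq_0_iff less_irrefl norm_minus_cancel norm_one)
  have e1: "lambert q 0 z + lambert q 0 (q * z) = - (1 / (1 + q * z))"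
    by (rule lambert_functional_equation[OF qz])
  have "norm (q * (1 / (q * z))) < 1"
    using assms(1) q z0 by (simp add: norm_divide divide_less_eq)
  from lambert_functional_equation[OF this]
  have e2: "lambert q 0 (1 / (q * z)) + lambert q 0 (1 / z) = - (1 / (1 + 1 / z))"
    using q by simp
  have "elliptic q (q * z) + elliptic q z
      = (lambert q 0 z + lambert q 0 (q * z)) - (lambert q 0 (1 / (q * z)) + lambert q 0 (1 / z))
        + (1 / (1 + q * z) + 1 / (1 + z) - 1)"
    by (simp add: elliptic_def odd_lambert_def pole_part_def)
  also have "1 / (1 + 1 / z) = 1 - 1 / (1 + z)"
    using z0 n1 by (simp add: field_simps)
  hence "(lambert q 0 z + lambert q 0 (q * z)) - (lambert q 0 (1 / (q * z)) + lambert q 0 (1 / z))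
        + (1 / (1 + q * z) + 1 / (1 + z) - 1) = 0"
    unfolding e1 e2 by simp
  finally show ?thesis
    by (simp add: eq_neg_iff_add_eq_0)
qed

text \<open>Multiplication of z by q is a translation of t and commutes with d/dt: the chain rule
  factor q cancels the one in the denominator q z.\<close>

lemma antiperiodic_derivative:
  assumes f: "\<And>z. z \<in> annulus q \<Longrightarrow> z \<noteq> -1 \<Longrightarrow> (f has_field_derivative f' z / z) (at z)"
    and anti: "\<And>z. 1 < norm z \<Longrightarrow> norm z < 1 / norm q \<Longrightarrow> f (q * z) = - f z"
    and z: "1 < norm z" "norm z < 1 / norm q"
  shows "f' (q * z) = - f' z"
proof -
  have "z \<in> annulus q" "z \<noteq> -1"
    using z q by (auto intro!: annulusI)
  moreover have "q * z \<in> annulus q" "q * z \<noteq> -1"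
  proof -
    have "norm (q * z) < 1"
      using z(2) by (simp add: norm_less_inverse_norm_q_iff)
    moreover have "norm q * 1 < norm q * norm z"
      using q z by (intro mult_strict_left_mono) auto
    moreover have "1 < 1 / norm q" using q by simp
    ultimately show "q * z \<in> annulus q" unfolding annulus_def mem_Collect_eq norm_mult by linarith
    show "q * z \<noteq> -1"
      using \<open>norm (q * z) < 1\<close> by (metis less_irrefl norm_minus_cancel norm_one)
  qed
  ultimately have d: "(f has_field_derivative f' z / z) (at z)"
      "(f has_field_derivative f' (q * z) / (q * z)) (at (q * z))"
    using f by auto
  have "((\<lambda>z. q * z) has_field_derivative q) (at z)"
    by (auto intro!: derivative_eq_intros)
  from DERIV_chain2[OF d(2) this]
  have "((\<lambda>z. f (q * z)) has_field_derivative f' (q * z) / (q * z) * q) (at z)" .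
  moreover have "((\<lambda>z. - f z) has_field_derivative - (f' z / z)) (at z)"
    by (rule DERIV_minus[OF d(1)])
  hence "((\<lambda>z. f (q * z)) has_field_derivative - (f' z / z)) (at z)"
  proof (rule has_field_derivative_transform_within_open)
    show "open {z. 1 < norm z \<and> norm z < 1 / norm q}"
      by (intro open_Collect_conj open_Collect_less continuous_intros)
  qed (use z anti in auto)
  ultimately have "f' (q * z) / (q * z) * q = - (f' z / z)"
    by (rule DERIV_unique)
  thus ?thesis
    using \<open>z \<in> annulus q\<close> annulusD(1)[of z q] q by (simp add: divide_eq_eq)
qed

lemma elliptic2_antiperiodic:
  assumes "1 < norm z" "norm z < 1 / norm q"
  shows "elliptic2 q (q * z) = - elliptic2 q z"
proof (rule antiperiodic_derivative[of "elliptic1 q" "elliptic2 q"])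
  show "elliptic1 q (q * z) = - elliptic1 q z" if "1 < norm z" "norm z < 1 / norm q" for z
    by (rule antiperiodic_derivative[of "elliptic q" "elliptic1 q"])
       (use that in \<open>auto intro: elliptic_has_derivative elliptic_antiperiodic\<close>)
qed (use assms in \<open>auto intro: elliptic1_has_derivative\<close>)

end

section \<open>The differential equation and the product formula\<close>

context
  fixes q :: complex
  assumes q: "q \<noteq> 0" "norm q < 1"
begin

lemma odd_lambert_holomorphic: "odd_lambert q m holomorphic_on annulus q"
  using odd_lambert_has_derivative[OF q] open_annulus
  by (auto simp: holomorphic_on_open)

lemma odd_lambert_0_at_1: "odd_lambert q 0 1 = 0" "odd_lambert q 0 (- 1) = 0"
  by (simp_all add: odd_lambert_def)

lemma units_in_annulus: "1 \<in> annulus q" "- 1 \<in> annulus q"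
  using q by (auto simp: annulus_def)

lemma scaled_in_annulus:
  assumes z: "1 < norm z" "norm z < 1 / norm q"
  shows "z \<in> annulus q" "q * z \<in> annulus q"
    "z \<noteq> 1" "z \<noteq> -1" "q * z \<noteq> 1" "q * z \<noteq> -1"
proof -
  have qz: "norm (q * z) < 1"
    using z(2) by (simp add: norm_less_inverse_norm_q_iff[OF q])
  show "z \<in> annulus q" "z \<noteq> 1" "z \<noteq> -1"
    using z q by (auto intro!: annulusI)
  show "q * z \<noteq> 1" "q * z \<noteq> -1"
    using qz by auto
  have "norm q * 1 < norm q * norm z"
    using q z by (intro mult_strict_left_mono) auto
  moreover have "1 < 1 / norm q" using q by simp
  ultimately show "q * z \<in> annulus q"
    using qz unfolding annulus_def mem_Collect_eq norm_mult by linarith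
qed

text \<open>Write \<open>elliptic q\<close> as S + w with \<open>S\<close> holomorphic and w the
  pole part. In the difference of the two sides w^3 cancels; since \<open>S\<close> vanishes at -1,
  w S is holomorphic, and a suitable \<open>b\<close> removes the remaining simple pole. The
  difference is then constant and antiperiodic, hence zero.\<close>

theorem elliptic_ode:
  obtains b where "\<And>z. z \<in> annulus q \<Longrightarrow> z \<noteq> -1 \<Longrightarrow>
    elliptic2 q z = b * elliptic q z + 2 * elliptic q z ^ 3"
proof -
  define S where "S = odd_lambert q 0"
  have S: "S holomorphic_on annulus q" "S (-1) = 0"
    unfolding S_def by (rule odd_lambert_holomorphic odd_lambert_0_at_1)+
  define S1 where "S1 = (\<lambda>z. if z = -1 then deriv S (-1) else (S z - S (-1)) / (z - (-1)))"
  have S1: "S1 holomorphic_on annulus q"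
    unfolding S1_def by (rule pole_lemma_open[OF S(1) open_annulus])
  \<comment> \<open>The holomorphic extension of w S, because w = (1 - z) / (2 (1 + z)).\<close>
  define E where "E = (\<lambda>z. (1 - z) / 2 * S1 z)"
  have E: "E holomorphic_on annulus q"
    unfolding E_def by (intro holomorphic_intros S1) auto
  define E1 where "E1 = (\<lambda>z. if z = -1 then deriv E (-1) else (E z - E (-1)) / (z - (-1)))"
  have E1: "E1 holomorphic_on annulus q"
    unfolding E1_def by (rule pole_lemma_open[OF E open_annulus])
  \<comment> \<open>With this choice the terms - w / 2 - b w - 6 w E combine to - 6 w (E - E(-1)),
    whose singularity at -1 is removable.\<close>
  define b where "b = - 1 / 2 - 6 * E (-1)"
  define H where "H = (\<lambda>z. odd_lambert q 2 z - b * S z - 2 * S z ^ 3 - 6 * E z * S z - 3 * (1 - z) * E1 z)"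
  have H: "H holomorphic_on annulus q"
    unfolding H_def by (intro holomorphic_intros odd_lambert_holomorphic S E E1)
  have H_eq: "H z = elliptic2 q z - b * elliptic q z - 2 * elliptic q z ^ 3"
    if z: "z \<in> annulus q" "z \<noteq> -1" for z
  proof -
    have z1: "1 + z \<noteq> 0" using z(2) by (metis add_eq_0_iff)
    define w where "w = pole_part z"
    have w: "w = (1 - z) / (1 + z) / 2"
      using z1 by (simp add: w_def pole_part_def field_simps)
    have S1z: "S1 z = S z / (1 + z)" and E1z: "E1 z = (E z - E (-1)) / (1 + z)"
      using z(2) S(2) by (simp_all add: S1_def E1_def add.commute)
    have wS: "w * S z = E z"
      unfolding w E_def S1z by simp
    have wE: "6 * w * (E z - E (-1)) = 3 * (1 - z) * E1 z"
    proof -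
      have "6 * (x / u / 2) * d = 3 * x * (d / u)" for x u d :: complex
        by (cases "u = 0") (simp_all add: field_simps)
      thus ?thesis unfolding w E1z .
    qed
    have "elliptic2 q z - b * elliptic q z - 2 * elliptic q z ^ 3
        = odd_lambert q 2 z - b * S z - 2 * S z ^ 3 - 6 * (w * S z) * S z
          - 6 * w * (w * S z) - w / 2 - b * w"
      unfolding elliptic2_def elliptic_def S_def[symmetric] w_def[symmetric]
      by (simp add: power3_eq_cube algebra_simps)
    also have "\<dots> = odd_lambert q 2 z - b * S z - 2 * S z ^ 3 - 6 * E z * S z - 6 * w * (E z - E (-1))"
      unfolding wS b_def by (simp add: algebra_simps)
    finally show ?thesis
      unfolding H_def wE by simp
  qed
  have anti: "H (q * z) = - H z" if z: "1 < norm z" "norm z < 1 / norm q" for z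
    using scaled_in_annulus[OF z] elliptic_antiperiodic[OF q z] elliptic2_antiperiodic[OF q z]
    by (simp add: H_eq)
  have "norm (H (q * z)) = norm (H z)" if "1 < norm z" "norm z < 1 / norm q" for z
    using anti[OF that] by simp
  from constant_on_annulus[OF q H this] obtain c where c: "\<And>z. z \<in> annulus q \<Longrightarrow> H z = c"
    by blast
  obtain r where r: "1 < r" "r < 1 / norm q"
    using q dense[of 1 "1 / norm q"] by auto
  hence r': "1 < norm (complex_of_real r)" "norm (complex_of_real r) < 1 / norm q"
    by auto
  have "c = - c"
    using anti[OF r'] c scaled_in_annulus[OF r'] by simp
  hence "c = 0" by simp
  show ?thesis
  proof (rule that)
    fix z assume "z \<in> annulus q" "z \<noteq> -1"
    thus "elliptic2 q z = b * elliptic q z + 2 * elliptic q z ^ 3"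
      using H_eq[of z] c[of z] \<open>c = 0\<close> by (simp add: algebra_simps)
  qed
qed

text \<open>The factor (1 - z) / (1 + z) carries the zero at 1 and the pole at -1. Its values at z
  and -z are reciprocal, so the product of the values of \<open>elliptic q\<close> extends
  holomorphically; it is constant and can be compared at p and at 1.\<close>

lemma elliptic_product:
  assumes p: "p ^ 2 = q"
  shows "elliptic1 q 1 = - (elliptic q p * elliptic q (- p))"
proof -
  define S where "S = odd_lambert q 0"
  have S: "S holomorphic_on annulus q" "S 1 = 0"
    unfolding S_def by (rule odd_lambert_holomorphic odd_lambert_0_at_1)+
  define S1 where "S1 = (\<lambda>z. if z = 1 then deriv S 1 else (S z - S 1) / (z - 1))"
  have S1: "S1 holomorphic_on annulus q"
    unfolding S1_def by (rule pole_lemma_open[OF S(1) open_annulus])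
  define \<phi> where "\<phi> = (\<lambda>z. 1 / 2 - (1 + z) * S1 z)"
  have \<phi>: "\<phi> holomorphic_on annulus q"
    unfolding \<phi>_def by (intro holomorphic_intros S1)
  define G where "G = (\<lambda>z. \<phi> z * \<phi> (- z))"
  have "(\<phi> \<circ> uminus) holomorphic_on annulus q"
    by (rule holomorphic_on_compose_gen[OF _ \<phi>]) (auto intro!: holomorphic_intros simp: minus_in_annulus)
  hence G: "G holomorphic_on annulus q"
    unfolding G_def o_def by (intro holomorphic_intros \<phi>)
  have ell: "elliptic q z = (1 - z) / (1 + z) * \<phi> z" if "z \<noteq> 1" "z \<noteq> -1" for z
  proof -
    have nz: "1 + z \<noteq> 0" using that(2) by (metis add_eq_0_iff)
    have "S z = (z - 1) * S1 z"
      using that S(2) by (simp add: S1_def)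
    moreover have "pole_part z = (1 - z) / (1 + z) / 2"
      using nz by (simp add: pole_part_def field_simps)
    moreover have "(1 - z) / (1 + z) * ((1 + z) * S1 z) = (1 - z) * S1 z"
      using nz by simp
    ultimately show ?thesis
      unfolding elliptic_def S_def[symmetric] \<phi>_def right_diff_distrib
      by (simp add: left_diff_distrib)
  qed
  have G_eq: "G z = elliptic q z * elliptic q (- z)" if z: "z \<noteq> 1" "z \<noteq> -1" for z
  proof -
    have "1 + z \<noteq> 0" "1 - z \<noteq> 0"
      using z by (auto simp: add_eq_0_iff)
    moreover have "- z \<noteq> 1" "- z \<noteq> - 1"
      using z by (auto simp: minus_equation_iff[of z])
    ultimately show ?thesis
      using ell[OF z] ell[of "- z"] by (simp add: G_def)
  qed
  have "norm (G (q * z)) = norm (G z)" if z: "1 < norm z" "norm z < 1 / norm q" for z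
  proof -
    have "elliptic q (q * - z) = - elliptic q (- z)"
      using z by (intro elliptic_antiperiodic[OF q]) auto
    thus ?thesis
      using elliptic_antiperiodic[OF q z] scaled_in_annulus[OF z] by (simp add: G_eq norm_mult)
  qed
  from constant_on_annulus[OF q G this] obtain c where c: "\<And>z. z \<in> annulus q \<Longrightarrow> G z = c"
    by blast
  have np: "norm q = norm p ^ 2" and p0: "p \<noteq> 0"
    using p q by (auto simp flip: norm_power)
  have np1: "norm p < 1"
    using q(2) unfolding np by (simp add: power_less_one_iff)
  have "p \<in> annulus q"
  proof -
    have "norm p * norm p < norm p * 1"
      using np1 p0 by (intro mult_strict_left_mono) auto
    moreover have "1 < 1 / norm q" using q by simp
    ultimately show ?thesis
      using np1 np unfolding annulus_def by (simp add: power2_eq_square)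
  qed
  moreover have "p \<noteq> 1" "p \<noteq> -1" using np1 by auto
  ultimately have "elliptic q p * elliptic q (- p) = G 1"
    using G_eq c units_in_annulus by metis
  \<comment> \<open>Here \<open>\<phi>\<close> takes the value 1/2 - 2 S'(1) at 1 and 1/2 at
    -1.\<close>
  also have "G 1 = 1 / 4 - deriv S 1"
    by (simp add: G_def \<phi>_def S1_def field_simps)
  also have "deriv S 1 = odd_lambert q 1 1"
    using odd_lambert_has_derivative[OF q units_in_annulus(1), of 0] unfolding S_def
    by (simp add: DERIV_imp_deriv)
  finally show ?thesis
    by (simp add: elliptic1_def pole_part_def)
qed

end

section \<open>The value at a square root of q and the four square theorem\<close>

lemma elliptic_at_sqrt:
  assumes p: "p \<noteq> 0" "norm p < 1"
  shows "2 * elliptic (p ^ 2) p = sech_sum (- p)"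
proof -
  define q where "q = p ^ 2"
  have q: "q \<noteq> 0" "norm q < 1"
    using p by (auto simp: q_def norm_power power_less_one_iff)
  have nz: "1 + q ^ r \<noteq> 0" for r
    by (rule one_plus_q_power_neq_0[OF q])
  have "norm (q * p) < 1"
  proof -
    have "norm (q * p) \<le> 1 * norm p"
      using q by (subst norm_mult, intro mult_right_mono) auto
    thus ?thesis using p by simp
  qed
  hence s1: "summable (\<lambda>r. lambert_coeff q r * p ^ r)"
    using lambert_summable[OF q, of p 0] by (simp add: norm_less_inverse_norm_q_iff[OF q])
  have "q * (1 / p) = p"
    using p by (simp add: q_def power2_eq_square)
  hence s2: "summable (\<lambda>r. lambert_coeff q r * (1 / p) ^ r)"
    using lambert_summable[OF q, of "1 / p" 0] p unfolding norm_less_inverse_norm_q_iff[OF q] by simp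
  have s3: "summable (\<lambda>r. (- p) ^ r)"
    using p by (intro summable_geometric) auto
  \<comment> \<open>Over the denominator 1 + q^r, the two Lambert series and the geometric series
    for 1 / (1 + p) contribute -q^r, 1 and 1 + q^r times (-p)^r.\<close>
  have tm: "lambert_coeff q r * p ^ r - lambert_coeff q r * (1 / p) ^ r + (- p) ^ r = 2 * ((- p) ^ r / (1 + q ^ r))" for r
  proof -
    have "(- q) ^ r * p ^ r = (- p) ^ r * q ^ r" "(- q) ^ r * (1 / p) ^ r = (- p) ^ r"
      using p by (simp_all add: q_def power2_eq_square mult.assoc flip: power_mult_distrib)
    hence "lambert_coeff q r * p ^ r = - ((- p) ^ r * q ^ r / (1 + q ^ r))"
      "lambert_coeff q r * (1 / p) ^ r = - ((- p) ^ r / (1 + q ^ r))"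
      by (simp_all add: lambert_coeff_def)
    thus ?thesis
      using nz[of r] by (simp add: field_simps)
  qed
  have sum: "summable (\<lambda>r. 2 * ((- p) ^ r / (1 + q ^ r)))"
    unfolding tm[symmetric] by (intro summable_add summable_diff s1 s2 s3)
  have "elliptic q p + 1 / 2 = lambert q 0 p - lambert q 0 (1 / p) + (\<Sum>r. (- p) ^ r)"
    using p by (simp add: elliptic_def odd_lambert_def pole_part_def suminf_geometric)
  also have "\<dots> = (\<Sum>r. lambert_coeff q r * p ^ r - lambert_coeff q r * (1 / p) ^ r + (- p) ^ r)"
    by (simp add: lambert_def suminf_diff[OF s1 s2] suminf_add[OF summable_diff[OF s1 s2] s3])
  also have "\<dots> = (\<Sum>r. 2 * ((- p) ^ r / (1 + q ^ r)))"
    unfolding tm ..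
  also have "\<dots> = 1 + (\<Sum>r. 2 * ((- p) ^ Suc r / (1 + q ^ Suc r)))"
    using suminf_split_head[OF sum] by simp
  also have "(\<Sum>r. 2 * ((- p) ^ Suc r / (1 + q ^ Suc r))) = 2 * (\<Sum>r. (- p) ^ Suc r / (1 + q ^ Suc r))"
  proof -
    have "summable (\<lambda>r. 2 * ((- p) ^ Suc r / (1 + q ^ Suc r)))"
      by (subst summable_Suc_iff) (rule sum)
    from summable_mult[OF this, of "1 / 2"]
    have "summable (\<lambda>r. (- p) ^ Suc r / (1 + q ^ Suc r))"
      by (simp del: power_Suc)
    thus ?thesis by (rule suminf_mult)
  qed
  finally have half: "elliptic q p + 1 / 2 = 1 + 2 * (\<Sum>r. (- p) ^ Suc r / (1 + q ^ Suc r))" .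
  have "2 * elliptic q p = 2 * (elliptic q p + 1 / 2) - 1" by simp
  also have "\<dots> = 1 + 4 * (\<Sum>r. (- p) ^ Suc r / (1 + q ^ Suc r))"
    unfolding half by simp
  also have "(\<lambda>r. (- p) ^ Suc r / (1 + q ^ Suc r)) = (\<lambda>r. (- p) ^ Suc r / (1 + (- p) ^ (2 * Suc r)))"
    by (simp only: q_def power_mult[symmetric] power_mult[of "- p"] power2_minus)
  also have "1 + 4 * (\<Sum>r. (- p) ^ Suc r / (1 + (- p) ^ (2 * Suc r))) = sech_sum (- p)"
    using p by (intro sech_sum_expansion[symmetric]) auto
  finally show ?thesis by (simp add: q_def)
qed

text \<open>The product formula gives \<open>sech_sum\<close> at p and -p, where p^2 = q; each is a
  square of a theta value, and \<open>theta3_0_times_minus\<close> merges the two.\<close>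

theorem elliptic1_at_1:
  assumes q: "q \<noteq> 0" "norm q < 1"
  shows "elliptic1 q 1 = - (theta3_0 (- q) ^ 4 / 4)"
proof -
  define p where "p = csqrt q"
  have p2: "p ^ 2 = q" by (simp add: p_def)
  have p: "p \<noteq> 0" "norm p < 1"
    using q by (auto simp: power_less_one_iff norm_power simp flip: p2)
  hence p': "- p \<noteq> 0" "norm (- p) < 1" by auto
  have "4 * elliptic1 q 1 = - ((2 * elliptic (p ^ 2) p) * (2 * elliptic ((- p) ^ 2) (- p)))"
    unfolding elliptic_product[OF q p2] by (simp add: p2)
  also have "\<dots> = - (sech_sum (- p) * sech_sum p)"
    unfolding elliptic_at_sqrt[OF p] elliptic_at_sqrt[OF p'] by simp
  also have "\<dots> = - ((theta3_0 p * theta3_0 (- p)) ^ 2)"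
    unfolding sech_sum_eq_theta3_0_square[OF p] sech_sum_eq_theta3_0_square[OF p']
    by (simp add: power_mult_distrib)
  also have "\<dots> = - (theta3_0 (- q) ^ 4)"
    unfolding theta3_0_times_minus[OF p] p2 by simp
  finally show ?thesis by (simp add: field_simps)
qed

section \<open>The determinant formula\<close>

text \<open>Since \<open>U_series\<close> is an unordered sum, absolute convergence is needed. It
  holds because 1 lies strictly inside the disc of radius 1 / |q|, as the point \<open>x\<close>
  witnesses.\<close>

lemma lambert_at_1:
  assumes q: "q \<noteq> 0" "norm q < 1" and m: "m \<ge> 1"
  shows "lambert q m 1 = U_series m q"
proof -
  let ?f = "\<lambda>r. of_nat r ^ m * lambert_coeff q r"
  obtain x where x: "1 < x" "x < 1 / norm q"
    using q dense[of 1 "1 / norm q"] by auto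
  have "summable (\<lambda>r. ?f r * of_real x ^ r)"
    using x by (intro lambert_summable[OF q]) auto
  hence "summable (\<lambda>r. norm (?f r * 1 ^ r))"
    by (rule powser_insidea) (use x in auto)
  hence s: "summable (\<lambda>r. norm (?f r))" by simp
  have "(?f has_sum (\<Sum>r. ?f r)) UNIV"
    using s summable_norm_cancel[OF s] by (intro norm_summable_imp_has_sum summable_sums)
  hence "lambert q m 1 = infsum ?f UNIV"
    by (simp add: lambert_def infsumI)
  also have "\<dots> = U_series m q"
    unfolding U_series_def
  proof (rule infsum_cong_neutral)
    fix r :: nat assume r: "r \<in> UNIV \<inter> {1..}"
    then obtain k where k: "r = Suc k" by (cases r) auto
    have "- ((- q) ^ r) = (-1) ^ (r - 1) * q ^ r"
      by (subst power_minus) (simp add: k)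
    thus "?f r = (-1) ^ (r - 1) * (of_nat r ^ m * q ^ r / (1 + q ^ r))"
      unfolding lambert_coeff_def by (simp only: minus_divide_left times_divide_eq_right mult.left_commute)
  qed (use m in auto)
  finally show ?thesis .
qed

section \<open>Expansions in powers of t\<close>

context
  fixes q :: complex
  assumes q: "q \<noteq> 0" "norm q < 1"
begin

lemma eventually_exp_in_annulus:
  "eventually (\<lambda>t. exp t \<in> annulus q \<and> exp t \<noteq> -1) (nhds 0)"
proof -
  have "open (exp -` (annulus q - {-1}))"
    by (intro continuous_open_vimage open_Diff open_annulus) (auto intro!: continuous_intros)
  moreover have "0 \<in> exp -` (annulus q - {-1})"
    using units_in_annulus[OF q] by auto
  ultimately show ?thesis
    by (auto simp: eventually_nhds)
qed

text \<open>The chain rule factor \<open>exp t\<close> cancels the division by z, so z d/dz becomes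
  the formal derivative in t.\<close>

lemma has_fps_expansion_comp_exp_deriv:
  assumes f: "(\<lambda>t. f (exp t)) has_fps_expansion F"
    and f': "\<And>z. z \<in> annulus q \<Longrightarrow> z \<noteq> -1 \<Longrightarrow> (f has_field_derivative f' z / z) (at z)"
  shows "(\<lambda>t. f' (exp t)) has_fps_expansion fps_deriv F"
proof -
  have "deriv (\<lambda>t. f (exp t)) has_fps_expansion fps_deriv F"
    by (rule has_fps_expansion_deriv[OF f])
  moreover have "eventually (\<lambda>t. deriv (\<lambda>t. f (exp t)) t = f' (exp t)) (nhds 0)"
    using eventually_exp_in_annulus
  proof eventually_elim
    case (elim t)
    have "((\<lambda>t. f (exp t)) has_field_derivative f' (exp t) / exp t * exp t) (at t)"
      using elim by (intro DERIV_chain2[OF f'] DERIV_exp) auto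
    thus ?case by (simp add: DERIV_imp_deriv)
  qed
  ultimately show ?thesis
    by (subst (asm) has_fps_expansion_cong[OF _ refl]) auto
qed

definition lambert_fps :: "complex fps" where
  "lambert_fps = fps_expansion (\<lambda>t. odd_lambert q 0 (exp t)) 0"

lemma odd_lambert_has_fps_expansion:
  "(\<lambda>t. odd_lambert q m (exp t)) has_fps_expansion (fps_deriv ^^ m) lambert_fps"
proof (induction m)
  case 0
  have "(\<lambda>t. odd_lambert q 0 (exp t)) analytic_on {0}"
  proof -
    have "odd_lambert q 0 analytic_on exp ` {0}"
      using odd_lambert_holomorphic[OF q] units_in_annulus[OF q] open_annulus
      by (auto simp: analytic_on_open[symmetric] intro: analytic_on_subset)
    moreover have "exp analytic_on {0 :: complex}"
      using holomorphic_on_exp[of UNIV] by (auto simp: analytic_on_open[symmetric] intro: analytic_on_subset)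
    ultimately show ?thesis
      using analytic_on_compose[of exp "{0}" "odd_lambert q 0"] by (simp add: o_def)
  qed
  thus ?case
    by (simp add: lambert_fps_def analytic_at_imp_has_fps_expansion_0)
next
  case (Suc m)
  from has_fps_expansion_comp_exp_deriv[OF this odd_lambert_has_derivative[OF q]]
  show ?case by simp
qed

text \<open>At z = 1 the two halves of \<open>odd_lambert\<close> coincide and, for odd m, add
  up.\<close>

lemma lambert_fps_nth:
  assumes "odd m"
  shows "fact m * fps_nth lambert_fps m = 2 * U_series m q"
proof -
  have m: "m \<ge> 1" using assms by (cases m) auto
  have "fact m * fps_nth lambert_fps m = fps_nth ((fps_deriv ^^ m) lambert_fps) 0"
    by (simp add: fps_0th_higher_deriv)
  also have "\<dots> = odd_lambert q m (exp 0)"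
    by (rule has_fps_expansion_imp_0_eq_fps_nth_0[OF odd_lambert_has_fps_expansion, symmetric])
  also have "\<dots> = 2 * U_series m q"
    using assms by (simp add: odd_lambert_def lambert_at_1[OF q m])
  finally show ?thesis .
qed

lemma pole_part_has_fps_expansion: "(\<lambda>t. pole_part (exp t)) has_fps_expansion logistic_fps"
  unfolding pole_part_def logistic_fps_def inverse_eq_divide[symmetric]
  by (intro has_fps_expansion_diff has_fps_expansion_inverse has_fps_expansion_add
        has_fps_expansion_1 has_fps_expansion_exp1 has_fps_expansion_const) auto

definition elliptic_fps :: "complex fps" where
  "elliptic_fps = lambert_fps + logistic_fps"

lemma elliptic_has_fps_expansion: "(\<lambda>t. elliptic q (exp t)) has_fps_expansion elliptic_fps"
  unfolding elliptic_def elliptic_fps_def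
  using has_fps_expansion_add[OF odd_lambert_has_fps_expansion[of 0] pole_part_has_fps_expansion] by simp

lemma elliptic1_has_fps_expansion: "(\<lambda>t. elliptic1 q (exp t)) has_fps_expansion fps_deriv elliptic_fps"
  by (rule has_fps_expansion_comp_exp_deriv[OF elliptic_has_fps_expansion elliptic_has_derivative[OF q]])

text \<open>The equation holds at e^t for t near 0, and power series expansions are unique.\<close>

lemma elliptic_fps_ode:
  obtains b where "fps_deriv (fps_deriv elliptic_fps) = fps_const b * elliptic_fps + 2 * elliptic_fps ^ 3"
proof -
  obtain b where b: "\<And>z. z \<in> annulus q \<Longrightarrow> z \<noteq> -1 \<Longrightarrow>
      elliptic2 q z = b * elliptic q z + 2 * elliptic q z ^ 3"
    using elliptic_ode[OF q] by blast
  have "(\<lambda>t. elliptic2 q (exp t)) has_fps_expansion fps_deriv (fps_deriv elliptic_fps)"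
    by (rule has_fps_expansion_comp_exp_deriv[OF elliptic1_has_fps_expansion elliptic1_has_derivative[OF q]])
  moreover have "eventually (\<lambda>t. elliptic2 q (exp t) = b * elliptic q (exp t) + 2 * elliptic q (exp t) ^ 3) (nhds 0)"
    using eventually_exp_in_annulus by eventually_elim (use b in auto)
  ultimately have "(\<lambda>t. b * elliptic q (exp t) + 2 * elliptic q (exp t) ^ 3) has_fps_expansion
      fps_deriv (fps_deriv elliptic_fps)"
    by (subst (asm) has_fps_expansion_cong[OF _ refl]) auto
  moreover have "(\<lambda>t. b * elliptic q (exp t) + 2 * elliptic q (exp t) ^ 3) has_fps_expansion
      fps_const b * elliptic_fps + 2 * elliptic_fps ^ 3"
    by (intro has_fps_expansion_add has_fps_expansion_mult has_fps_expansion_power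
          has_fps_expansion_const has_fps_expansion_numeral elliptic_has_fps_expansion)
  ultimately show ?thesis
    by (intro that fps_expansion_unique_complex)
qed

lemma elliptic_fps_nth_0: "fps_nth elliptic_fps 0 = 0"
  using has_fps_expansion_imp_0_eq_fps_nth_0[OF elliptic_has_fps_expansion]
  by (simp add: elliptic_def odd_lambert_def pole_part_def)

lemma elliptic_fps_nth_1: "fps_nth elliptic_fps 1 = - (theta3_0 (- q) ^ 4 / 4)"
  using has_fps_expansion_imp_0_eq_fps_nth_0[OF elliptic1_has_fps_expansion] elliptic1_at_1[OF q]
  by simp

text \<open>The Lambert part contributes 2 U and the pole part -2 c.\<close>

lemma elliptic_fps_nth_odd:
  "fact (2 * k + 1) * fps_nth elliptic_fps (2 * k + 1) = 2 * g_coeff q (k + 1)"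
  using lambert_fps_nth[of "2 * k + 1"] logistic_fps_c_coeff[of "k + 1"]
  by (simp add: elliptic_fps_def g_coeff_def distrib_left del: fact_Suc)

end

theorem theorem5p3:
  fixes q :: complex and n :: nat
  assumes "0 < norm q" and "norm q < 1" and "n \<ge> 1"
  shows "theta3_0 (-q) ^ (4 * n\<^sup>2) =
    ((-1) ^ n * 2 ^ (2 * n\<^sup>2 + n) * (\<Prod>r = 1..2 * n - 1. inverse (fact r))) *
    Determinant.det (g_mat q n)"
proof -
  have q: "q \<noteq> 0" "norm q < 1" using assms by auto
  define f where "f = elliptic_fps q"
  obtain b where ode: "fps_deriv (fps_deriv f) = fps_const b * f + 2 * f ^ 3"
    using elliptic_fps_ode[OF q] unfolding f_def by blast
  have "mat n n (\<lambda>(i, j). fact (2 * (i + j) + 1) * fps_nth f (2 * (i + j) + 1)) = 2 \<cdot>\<^sub>m g_mat q n"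
  proof (rule eq_matI)
    fix i j assume "i < dim_row (2 \<cdot>\<^sub>m g_mat q n)" "j < dim_col (2 \<cdot>\<^sub>m g_mat q n)"
    thus "mat n n (\<lambda>(i, j). fact (2 * (i + j) + 1) * fps_nth f (2 * (i + j) + 1)) $$ (i, j)
        = (2 \<cdot>\<^sub>m g_mat q n) $$ (i, j)"
      using elliptic_fps_nth_odd[OF q, of "i + j"] by (simp add: g_mat_def f_def del: fact_Suc)
  qed (simp_all add: g_mat_def)
  \<comment> \<open>The scalar 2 in each of the n rows contributes 2^n.\<close>
  hence "2 ^ n * Determinant.det (g_mat q n) = (\<Prod>r = 1..2 * n - 1. fact r) * fps_nth f 1 ^ (n ^ 2)"
    using hankel_det_of_ode[OF ode _ assms(3)] elliptic_fps_nth_0[OF q]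
    by (simp add: f_def g_mat_def)
  also have "fps_nth f 1 ^ (n ^ 2) = (-1) ^ n * theta3_0 (- q) ^ (4 * n ^ 2) / 2 ^ (2 * n ^ 2)"
  proof -
    \<comment> \<open>The integers n and n^2 have the same parity.\<close>
    have "(-1) ^ (n ^ 2) = ((-1) ^ n :: complex)"
      by (cases "even n") auto
    moreover have "(4 :: complex) ^ (n ^ 2) = 2 ^ (2 * n ^ 2)"
      by (simp add: power_mult)
    ultimately show ?thesis
      unfolding f_def elliptic_fps_nth_1[OF q] by (subst power_minus) (simp add: power_divide power_mult)
  qed
  finally have det: "2 ^ n * Determinant.det (g_mat q n)
      = (\<Prod>r = 1..2 * n - 1. fact r) * ((-1) ^ n * theta3_0 (- q) ^ (4 * n ^ 2) / 2 ^ (2 * n ^ 2))" .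
  define P :: complex where "P = (\<Prod>r = 1..2 * n - 1. fact r)"
  have P: "(\<Prod>r = 1..2 * n - 1. inverse (fact r)) = inverse P" "P \<noteq> 0"
    by (simp_all add: P_def prod_inversef[symmetric] o_def)
  \<comment> \<open>The power of 2 is split: 2^n belongs to the scaled determinant, and 2^(2 n^2)
    cancels the denominators 4 of the linear coefficient.\<close>
  have "((-1) ^ n * 2 ^ (2 * n\<^sup>2 + n) * inverse P) * Determinant.det (g_mat q n)
      = (-1) ^ n * 2 ^ (2 * n ^ 2) * inverse P * (2 ^ n * Determinant.det (g_mat q n))"
    by (simp add: power_add)
  also have "\<dots> = ((-1) ^ n * (-1) ^ n) * theta3_0 (- q) ^ (4 * n ^ 2)"
    unfolding det P_def[symmetric] using P(2) by (simp add: field_simps)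
  also have "(-1) ^ n * (-1) ^ n = (1 :: complex)"
    by (simp flip: power_add)
  finally show ?thesis
    unfolding P by simp
qed

end
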